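(* Let $r(K_3,Q_n)$ denote the smallest integer $N$ such that every red-blue colouring of the edges of the complete graph $K_N$ contains either a red copy of the $n$-dimensional hypercube $Q_n$ or a blue triangle. Then \[ r(K_3,Q_n) = \big(1+o(1)\big)\,2^{n+1} \quad \text{as } n\to\infty. \]
   Context: $Q_n$ is the graph with vertex set $\{0,1\}^n$ in which two vertices are adjacent if and only if they differ in exactly one coordinate. *)

theory Defs
  imports Complex_Main "HOL-Library.Ramsey" "HOL-Library.Landau_Symbols"
begin

text \<open>
  A simple graph is a pair of a vertex set and an edge set, the edges being two-element sets of
  vertices.
\<close>

type_synonym 'a graph = "'a set \<times> 'a set set"

abbreviation verts :: "'a graph \<Rightarrow> 'a set" where "verts \<equiv> fst"
abbreviation edges :: "'a graph \<Rightarrow> 'a set set" where "edges \<equiv> snd"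

definition complete_graph :: "nat \<Rightarrow> nat graph" where
  "complete_graph N = ({..<N}, [{..<N}]\<^bsup>2\<^esup>)"

text \<open>The vertex set of the cube consists of the 0/1-vectors of length \<open>n\<close>, as Boolean lists.\<close>

definition hypercube :: "nat \<Rightarrow> bool list graph" where
  "hypercube n =
    ({x. length x = n},
     {{x, y} | x y. length x = n \<and> length y = n \<and> card {i. i < n \<and> x ! i \<noteq> y ! i} = 1})"

text \<open>A copy of \<open>H\<close> in \<open>G\<close> is a subgraph of \<open>G\<close>, not necessarily induced, isomorphic to \<open>H\<close>.\<close>

definition contains_copy :: "'a graph \<Rightarrow> 'b graph \<Rightarrow> bool" where
  "contains_copy G H \<longleftrightarrow>
    (\<exists>f. inj_on f (verts H) \<and> f ` verts H \<subseteq> verts G \<and> (\<forall>e \<in> edges H. f ` e \<in> edges G))"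

datatype colour = Red | Blue

definition colour_subgraph :: "'a graph \<Rightarrow> ('a set \<Rightarrow> colour) \<Rightarrow> colour \<Rightarrow> 'a graph" where
  "colour_subgraph G \<chi> c = (verts G, {e \<in> edges G. \<chi> e = c})"

definition ramsey_prop :: "'a graph \<Rightarrow> 'b graph \<Rightarrow> nat \<Rightarrow> bool" where
  "ramsey_prop G H N \<longleftrightarrow>
    (\<forall>\<chi>. contains_copy (colour_subgraph (complete_graph N) \<chi> Red) H
       \<or> contains_copy (colour_subgraph (complete_graph N) \<chi> Blue) G)"

definition ramsey_number :: "'a graph \<Rightarrow> 'b graph \<Rightarrow> nat" where
  "ramsey_number G H = (LEAST N. ramsey_prop G H N)"

text \<open>
  The minimum above exists for all finite graphs, by Ramsey's theorem.
\<close>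

lemma contains_copy_of_clique:
  assumes fin: "finite (verts H)" and wf: "edges H \<subseteq> [verts H]\<^bsup>2\<^esup>"
    and K: "K \<subseteq> verts G" "finite K" "card K = card (verts H)" "[K]\<^bsup>2\<^esup> \<subseteq> edges G"
  shows "contains_copy G H"
proof -
  obtain f where f: "bij_betw f (verts H) K"
    using fin K by (metis finite_same_card_bij)
  have "f ` e \<in> edges G" if "e \<in> edges H" for e
  proof -
    have "f ` e \<in> [K]\<^bsup>2\<^esup>"
      using bij_betw_nsets[OF f, of 2] that wf by (auto simp: bij_betw_def)
    then show ?thesis using K by auto
  qed
  then show ?thesis
    unfolding contains_copy_def using f K by (auto simp: bij_betw_def)
qed

lemma ramsey_prop_exists:
  assumes "finite (verts G)" "edges G \<subseteq> [verts G]\<^bsup>2\<^esup>"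
    and "finite (verts H)" "edges H \<subseteq> [verts H]\<^bsup>2\<^esup>"
  shows "\<exists>N. ramsey_prop G H N"
proof -
  let ?g = "card (verts G)" and ?h = "card (verts H)"
  obtain N :: nat where N: "partn_lst {..<N} [?h, ?g] 2"
    using ramsey2_full by blast
  have "contains_copy (colour_subgraph (complete_graph N) \<chi> Red) H
       \<or> contains_copy (colour_subgraph (complete_graph N) \<chi> Blue) G" for \<chi>
  proof -
    define f where "f = (\<lambda>e. if \<chi> e = Red then 0 else 1 :: nat)"
    have "f \<in> [{..<N}]\<^bsup>2\<^esup> \<rightarrow> {..<length [?h, ?g]}" by (auto simp: f_def)
    then obtain i K where i: "i < length [?h, ?g]"
      and K: "K \<in> [{..<N}]\<^bsup>([?h, ?g] ! i)\<^esup>" "f ` ([K]\<^bsup>2\<^esup>) \<subseteq> {i}"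
      using N unfolding partn_lst_def monochromatic_def by blast
    have sub: "K \<subseteq> {..<N}" "finite K" "card K = [?h, ?g] ! i" using K by (auto simp: nsets_def)
    have mono: "[K]\<^bsup>2\<^esup> \<subseteq> [{..<N}]\<^bsup>2\<^esup>" using sub by (simp add: nsets_mono)
    consider "i = 0" | "i = 1" using i by fastforce
    then show ?thesis
    proof cases
      case 1
      then have "\<chi> e = Red" if "e \<in> [K]\<^bsup>2\<^esup>" for e
      proof -
        have "f e = 0" using K(2) that 1 by blast
        then show ?thesis by (simp add: f_def split: if_splits)
      qed
      then have "contains_copy (colour_subgraph (complete_graph N) \<chi> Red) H"
        using 1 sub mono assms
        by (intro contains_copy_of_clique[of H K])
           (auto simp: colour_subgraph_def complete_graph_def)
      then show ?thesis ..
    next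
      case 2
      then have "\<chi> e = Blue" if "e \<in> [K]\<^bsup>2\<^esup>" for e
      proof -
        have "f e = 1" using K(2) that 2 by blast
        then show ?thesis by (cases "\<chi> e") (auto simp: f_def)
      qed
      then have "contains_copy (colour_subgraph (complete_graph N) \<chi> Blue) G"
        using 2 sub mono assms
        by (intro contains_copy_of_clique[of G K])
           (auto simp: colour_subgraph_def complete_graph_def)
      then show ?thesis ..
    qed
  qed
  then show ?thesis unfolding ramsey_prop_def by blast
qed

lemma ramsey_prop_triangle_hypercube: "\<exists>N. ramsey_prop (complete_graph 3) (hypercube n) N"
proof (rule ramsey_prop_exists)
  have "finite {x :: bool list. set x \<subseteq> UNIV \<and> length x = n}"
    by (rule finite_lists_length_eq) simp
  then show "finite (verts (hypercube n))" by (simp add: hypercube_def)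
  show "edges (hypercube n) \<subseteq> [verts (hypercube n)]\<^bsup>2\<^esup>"
    by (auto simp: hypercube_def)
qed (auto simp: complete_graph_def)

end

theory Submission
  imports Defs
begin

text \<open>
  Two red cliques of size \<open>2 ^ n - 1\<close> joined in blue give the lower bound. For the upper bound let \<open>G\<close>
  be the blue graph, triangle-free on \<open>(2 + \<epsilon>) 2 ^ n\<close> vertices; the cube has to be embedded into its
  complement. Neighbourhoods in \<open>G\<close> are independent, so almost all of \<open>G\<close> splits into pieces of size
  slightly above \<open>2 ^ (n - r)\<close>, with \<open>r = O(log n)\<close>, that are independent or have very small inner
  degree. If all degrees are at most \<open>2 ^ n\<close> times a small negative power of \<open>n\<close>, most pairs of
  pieces are so sparse that the subcubes of codimension \<open>r\<close> can be assigned to pieces greedily.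

  Otherwise some neighbourhood contains a large independent set \<open>C\<close>. Cut coordinates into \<open>r\<close> long
  blocks and split the cube by the majority in each block: the \<open>2 ^ r\<close> classes touch only in a
  separator of density about \<open>r / sqrt k\<close>, with \<open>k\<close> the block length, and this fits into \<open>C\<close>. So \<open>2 ^ r\<close> pieces suffice
  if each is linked to \<open>C\<close>, that is, contains many disjoint small sets that are nearly non-adjacent to
  small subsets of \<open>C\<close>. If there are not enough linked pieces, then slightly more than half of \<open>G\<close> is
  made of pieces unlinked to \<open>C\<close>. If the degrees inside this half are small, the first case applies to
  it; otherwise a large independent set \<open>C2\<close> inside it serves as the new centre, because three mutually
  unlinked sets would contain a triangle.
\<close>

section \<open>Greedy embeddings and near-independent pieces\<close>

text \<open>Cube vertices are handled as subsets of \<open>{..<n}\<close>, so that an edge toggles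
  one element; the Boolean lists of \<open>hypercube\<close> return only in the last
  section.\<close>

definition flip :: "nat \<Rightarrow> nat set \<Rightarrow> nat set" where
  "flip j S = (if j \<in> S then S - {j} else insert j S)"

definition cube_adj :: "nat \<Rightarrow> nat set \<Rightarrow> nat set \<Rightarrow> bool" where
  "cube_adj n S S' \<longleftrightarrow> (\<exists>j<n. S' = flip j S)"

lemma flip_flip [simp]: "flip j (flip j S) = S"
  by (auto simp: flip_def)

lemma flip_inject: "flip i S = flip j S \<longleftrightarrow> i = j"
  by (auto simp: flip_def split: if_splits)

lemma cube_adj_sym: "cube_adj n S S' \<Longrightarrow> cube_adj n S' S"
  unfolding cube_adj_def by (metis flip_flip)

lemma cube_adj_irrefl: "\<not> cube_adj n S S"
  unfolding cube_adj_def flip_def by (auto split: if_splits)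

lemma flip_subset: "S \<subseteq> {..<n} \<Longrightarrow> j < n \<Longrightarrow> flip j S \<subseteq> {..<n}"
  by (auto simp: flip_def)

text \<open>Distinct directions give distinct neighbours. This evaluates the neighbour sum in the
  hypothesis \<open>room\<close> of \<open>greedy_embedding\<close>.\<close>

lemma sum_cube_nbs:
  assumes "S \<subseteq> {..<n}"
  shows "(\<Sum>S' | S' \<in> Pow {..<n} \<and> cube_adj n S S'. f S') = (\<Sum>j<n. f (flip j S))"
proof -
  have "{S'. S' \<in> Pow {..<n} \<and> cube_adj n S S'} = (\<lambda>j. flip j S) ` {..<n}"
    using flip_subset[OF assms] by (auto simp: cube_adj_def)
  moreover have "inj_on (\<lambda>j. flip j S) {..<n}"
    by (auto simp: inj_on_def flip_inject)
  ultimately show ?thesis by (simp add: sum.reindex)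
qed

text \<open>
  Vertices are embedded in order of increasing rank. In both applications the relation \<open>conf\<close> need
  only be controlled in the direction from an already embedded vertex to a new one, which is why
  the bound \<open>w\<close> is one-sided.
\<close>

lemma greedy_embedding:
  fixes rank :: "'h \<Rightarrow> nat" and w :: "'h \<Rightarrow> 'h \<Rightarrow> nat" and cand :: "'h \<Rightarrow> 'b set"
  assumes "finite H" and sym: "\<And>h h'. nb h h' \<Longrightarrow> nb h' h" and irr: "\<And>h. \<not> nb h h"
    and fin: "\<And>h. h \<in> H \<Longrightarrow> finite (cand h)"
    and w: "\<And>h h' v. h \<in> H \<Longrightarrow> h' \<in> H \<Longrightarrow> nb h h' \<Longrightarrow> rank h' \<le> rank h \<Longrightarrow> v \<in> cand h'
      \<Longrightarrow> card {u \<in> cand h. conf v u} \<le> w h h'"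
    and room: "\<And>h. h \<in> H \<Longrightarrow> card {h' \<in> H. h' \<noteq> h \<and> cand h' \<inter> cand h \<noteq> {}}
      + (\<Sum>h' | h' \<in> H \<and> nb h h'. w h h') < card (cand h)"
  shows "\<exists>f. inj_on f H \<and> (\<forall>h\<in>H. f h \<in> cand h) \<and>
    (\<forall>h\<in>H. \<forall>h'\<in>H. nb h h' \<longrightarrow> rank h' \<le> rank h \<and> \<not> conf (f h') (f h)
       \<or> rank h \<le> rank h' \<and> \<not> conf (f h) (f h'))"
proof -
  have "S \<subseteq> H \<Longrightarrow> \<exists>f. inj_on f S \<and> (\<forall>h\<in>S. f h \<in> cand h) \<and>
    (\<forall>h\<in>S. \<forall>h'\<in>S. nb h h' \<longrightarrow> rank h' \<le> rank h \<and> \<not> conf (f h') (f h)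
       \<or> rank h \<le> rank h' \<and> \<not> conf (f h) (f h'))" if "finite S" for S
    using that
  proof (induction S rule: finite_ranking_induct[where f = rank])
    case empty
    then show ?case by auto
  next
    case (insert x S)
    show ?case
    proof (cases "x \<in> S")
      case True
      then show ?thesis using insert by (simp add: insert_absorb)
    next
      case False
      from insert obtain f where f: "inj_on f S" "\<forall>h\<in>S. f h \<in> cand h"
        "\<forall>h\<in>S. \<forall>h'\<in>S. nb h h' \<longrightarrow> rank h' \<le> rank h \<and> \<not> conf (f h') (f h)
           \<or> rank h \<le> rank h' \<and> \<not> conf (f h) (f h')"
        by auto
      have xH: "x \<in> H" and SH: "S \<subseteq> H" using insert by auto
      \<comment> \<open>\<open>O1\<close> contains every used image that can lie in
        \<open>cand x\<close>, and \<open>O2\<close> the candidates spoiled by embedded neighbours;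
        by \<open>room\<close> the two cannot cover \<open>cand x\<close>.\<close>
      define O1 where "O1 = f ` {h' \<in> H. h' \<in> S \<and> cand h' \<inter> cand x \<noteq> {}}"
      define O2 where "O2 = (\<Union>h' \<in> {h' \<in> S. nb x h'}. {u \<in> cand x. conf (f h') u})"
      have finS: "finite S" using \<open>finite H\<close> SH finite_subset by blast
      have "card O1 \<le> card {h' \<in> H. h' \<in> S \<and> cand h' \<inter> cand x \<noteq> {}}"
        unfolding O1_def using \<open>finite H\<close> by (intro card_image_le) auto
      also have "\<dots> \<le> card {h' \<in> H. h' \<noteq> x \<and> cand h' \<inter> cand x \<noteq> {}}"
        using \<open>finite H\<close> False by (intro card_mono) auto
      finally have c1: "card O1 \<le> card {h' \<in> H. h' \<noteq> x \<and> cand h' \<inter> cand x \<noteq> {}}" .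
      have "card O2 \<le> (\<Sum>h' \<in> {h' \<in> S. nb x h'}. card {u \<in> cand x. conf (f h') u})"
        unfolding O2_def using finS by (intro card_UN_le) auto
      also have "\<dots> \<le> (\<Sum>h' \<in> {h' \<in> S. nb x h'}. w x h')"
        using insert.hyps(2) f(2) SH xH by (intro sum_mono w) auto
      also have "\<dots> \<le> (\<Sum>h' | h' \<in> H \<and> nb x h'. w x h')"
        using SH \<open>finite H\<close> by (intro sum_mono2) auto
      finally have c2: "card O2 \<le> (\<Sum>h' | h' \<in> H \<and> nb x h'. w x h')" .
      have "card (O1 \<union> O2) < card (cand x)"
        using c1 c2 room[OF xH] card_Un_le[of O1 O2] by linarith
      moreover have "finite (O1 \<union> O2)"
        using \<open>finite H\<close> finS fin[OF xH] by (auto simp: O1_def O2_def)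
      ultimately have "\<not> cand x \<subseteq> O1 \<union> O2"
        by (meson card_mono not_less)
      then obtain u where u: "u \<in> cand x" "u \<notin> O1" "u \<notin> O2" by blast
      have new: "u \<noteq> f h" if "h \<in> S" for h
        using u(1,2) f(2) that SH by (auto simp: O1_def)
      have nc: "\<not> conf (f h) u" if "h \<in> S" "nb x h" for h
        using u(1,3) that by (auto simp: O2_def)
      have eq: "(f(x := u)) h = f h" if "h \<in> S" for h
        using that False by auto
      have "inj_on (f(x := u)) (insert x S)"
        using f(1) new False by (auto simp: inj_on_def)
      moreover have "\<forall>h\<in>insert x S. (f(x := u)) h \<in> cand h"
        using f(2) u(1) by auto
      moreover have "rank h' \<le> rank h \<and> \<not> conf ((f(x := u)) h') ((f(x := u)) h)
           \<or> rank h \<le> rank h' \<and> \<not> conf ((f(x := u)) h) ((f(x := u)) h')"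
        if hh: "h \<in> insert x S" "h' \<in> insert x S" "nb h h'" for h h'
      proof -
        consider "h = x" "h' \<in> S" | "h' = x" "h \<in> S" | "h \<in> S" "h' \<in> S"
          using hh irr[of x] by blast
        then show ?thesis
        proof cases
          case 1
          then show ?thesis using hh nc insert.hyps(2) False by auto
        next
          case 2
          then show ?thesis using hh nc insert.hyps(2) False sym by auto
        next
          case 3
          then show ?thesis using hh f(3) eq by auto
        qed
      qed
      ultimately show ?thesis by blast
    qed
  qed
  then show ?thesis using \<open>finite H\<close> by blast
qed

lemma split_into_pieces:
  fixes S :: "'a set"
  assumes "finite S" "K > 0"
  shows "\<exists>F. finite F \<and> pairwise disjnt F \<and> (\<forall>P\<in>F. P \<subseteq> S \<and> card P = K) \<and> card (S - \<Union>F) < K"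
  using assms(1)
proof (induction S rule: finite_psubset_induct)
  case (psubset S)
  show ?case
  proof (cases "card S < K")
    case True
    then show ?thesis by (intro exI[of _ "{}"]) auto
  next
    case False
    then obtain P where P: "P \<subseteq> S" "card P = K" "finite P"
      by (metis obtain_subset_with_card_n not_less)
    moreover have "P \<noteq> {}" using P \<open>K > 0\<close> by auto
    ultimately have "S - P \<subset> S" by blast
    from psubset.IH[OF this] obtain F where F: "finite F" "pairwise disjnt F"
      "\<forall>Q\<in>F. Q \<subseteq> S - P \<and> card Q = K" "card (S - P - \<Union>F) < K" by auto
    have "pairwise disjnt (insert P F)"
      using F(2,3) by (auto simp: pairwise_insert disjnt_def)
    moreover have "S - \<Union>(insert P F) = S - P - \<Union>F" by auto
    ultimately show ?thesis
      using F P by (intro exI[of _ "insert P F"]) auto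
  qed
qed

section \<open>Triangle-free graphs and their near-independent pieces\<close>

text \<open>The axioms on \<open>adj\<close> range over the whole type, which spares membership
  conditions; an instance has to restrict its relation to the vertices itself.\<close>

locale triangle_free =
  fixes V :: "'a set" and adj :: "'a \<Rightarrow> 'a \<Rightarrow> bool"
  assumes finite_V: "finite V"
    and adj_sym: "adj u v \<Longrightarrow> adj v u"
    and adj_irrefl: "\<not> adj u u"
    and no_triangle: "adj u v \<Longrightarrow> adj v w \<Longrightarrow> \<not> adj u w"
begin

text \<open>A copy of the cube in the complement of \<open>adj\<close>, not necessarily induced:
  only cube edges are constrained.\<close>

definition cube_embeds :: "nat \<Rightarrow> bool" where
  "cube_embeds n \<longleftrightarrow> (\<exists>f. inj_on f (Pow {..<n}) \<and> f ` Pow {..<n} \<subseteq> V \<and>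
     (\<forall>S\<in>Pow {..<n}. \<forall>S'\<in>Pow {..<n}. cube_adj n S S' \<longrightarrow> \<not> adj (f S) (f S')))"

text \<open>A partition with the fewest edges inside its classes works.\<close>

lemma balanced_partition:
  assumes "D \<subseteq> V" "M > 0"
  shows "\<exists>g :: 'a \<Rightarrow> nat. (\<forall>v\<in>D. g v < M) \<and>
    (\<forall>v\<in>D. M * card {u \<in> D. adj v u \<and> g u = g v} \<le> card {u \<in> D. adj v u})"
proof -
  define E where "E = (\<lambda>g :: 'a \<Rightarrow> nat. {(u, v). u \<in> D \<and> v \<in> D \<and> adj u v \<and> g u = g v})"
  have finD: "finite D" using assms finite_V finite_subset by blast
  obtain g where g: "\<forall>v\<in>D. g v < M" and
    gmin: "\<And>g'. \<forall>v\<in>D. g' v < M \<Longrightarrow> card (E g) \<le> card (E g')"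
    using ex_has_least_nat[of "\<lambda>g. \<forall>v\<in>D. g v < M" "\<lambda>_. 0" "\<lambda>g. card (E g)"] assms by auto
  have own: "card {u \<in> D. adj v u \<and> g u = g v} \<le> card {u \<in> D. adj v u \<and> g u = j}"
    if v: "v \<in> D" and j: "j < M" for v j
  proof (cases "j = g v")
    case False
    \<comment> \<open>\<open>R\<close> consists of the ordered pairs avoiding \<open>v\<close> and
      does not change when \<open>v\<close> alone is moved. Minimality therefore compares the
      numbers of neighbours of \<open>v\<close> in its own class and in class
      \<open>j\<close>.\<close>
    define R where "R = {(x, y). x \<in> D - {v} \<and> y \<in> D - {v} \<and> adj x y \<and> g x = g y}"
    have finR: "finite R"
      by (rule finite_subset[of _ "D \<times> D"]) (auto simp: R_def finD)
    have E: "card (E g') = card R + 2 * card {u \<in> D. adj v u \<and> g u = g' v}"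
      if g': "\<And>x. x \<noteq> v \<Longrightarrow> g' x = g x" for g'
    proof -
      let ?N = "{u \<in> D. adj v u \<and> g u = g' v}"
      have "E g' = R \<union> ({v} \<times> ?N \<union> ?N \<times> {v})"
        using v g' adj_irrefl adj_sym by (auto simp: E_def R_def) metis+
      moreover have "R \<inter> ({v} \<times> ?N \<union> ?N \<times> {v}) = {}" by (auto simp: R_def)
      moreover have "({v} \<times> ?N) \<inter> (?N \<times> {v}) = {}" using adj_irrefl by auto
      moreover have "finite ?N" using finD by auto
      ultimately show ?thesis
        using finR by (simp add: card_Un_disjoint card_cartesian_product)
    qed
    have "card (E g) \<le> card (E (g(v := j)))"
      using g j by (intro gmin) auto
    then show ?thesis using E[of g] E[of "g(v := j)"] by simp
  qed simp
  have "M * card {u \<in> D. adj v u \<and> g u = g v} \<le> card {u \<in> D. adj v u}" if v: "v \<in> D" for v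
  proof -
    have "M * card {u \<in> D. adj v u \<and> g u = g v} = (\<Sum>j<M. card {u \<in> D. adj v u \<and> g u = g v})"
      by simp
    also have "\<dots> \<le> (\<Sum>j<M. card {u \<in> D. adj v u \<and> g u = j})"
      using own[OF v] by (intro sum_mono) auto
    also have "\<dots> = card (\<Union>j<M. {u \<in> D. adj v u \<and> g u = j})"
      using finD by (intro card_UN_disjoint[symmetric]) auto
    also have "(\<Union>j<M. {u \<in> D. adj v u \<and> g u = j}) = {u \<in> D. adj v u}"
      using g by auto
    finally show ?thesis .
  qed
  then show ?thesis using g by blast
qed

text \<open>
  As long as some neighbourhood has \<open>K\<close> elements, it supplies an independent piece; what remains has
  degrees below \<open>K\<close>, and its balanced partition is cut up arbitrarily.
\<close>

lemma pieces_exist: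
  assumes "D \<subseteq> V" "K > 0" "M > 0"
  shows "\<exists>F. finite F \<and> pairwise disjnt F \<and>
    (\<forall>P\<in>F. P \<subseteq> D \<and> card P = K \<and> (\<forall>v\<in>P. M * card {u \<in> P. adj v u} \<le> K)) \<and>
    card (D - \<Union>F) \<le> M * K"
proof -
  have "finite D" using assms finite_V finite_subset by blast
  then show ?thesis using assms(1)
  proof (induction D rule: finite_psubset_induct)
    case (psubset D)
    show ?case
    proof (cases "\<exists>v. card {u \<in> D. adj v u} \<ge> K")
      case True
      then obtain v P where P: "P \<subseteq> {u \<in> D. adj v u}" "card P = K" "finite P"
        by (metis obtain_subset_with_card_n)
      moreover have "P \<noteq> {}" using P \<open>K > 0\<close> by auto
      ultimately have "D - P \<subset> D" by blast
      from psubset.IH[OF this] psubset.prems obtain F where F: "finite F" "pairwise disjnt F"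
        "\<forall>Q\<in>F. Q \<subseteq> D - P \<and> card Q = K \<and> (\<forall>v\<in>Q. M * card {u \<in> Q. adj v u} \<le> K)"
        "card (D - P - \<Union>F) \<le> M * K" by auto
      \<comment> \<open>\<open>P\<close> lies in a neighbourhood, so an edge inside it would close a
        triangle.\<close>
      have indep: "M * card {u \<in> P. adj x u} \<le> K" if "x \<in> P" for x
      proof -
        have "{u \<in> P. adj x u} = {}" using P(1) that no_triangle by blast
        then show ?thesis by (simp only: card.empty mult_0_right le0)
      qed
      have "pairwise disjnt (insert P F)"
        using F(2,3) by (auto simp: pairwise_insert disjnt_def)
      moreover have "card (D - \<Union>(insert P F)) \<le> M * K"
      proof -
        have "D - \<Union>(insert P F) = D - P - \<Union>F" by auto
        then show ?thesis using F(4) by metis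
      qed
      moreover have "\<forall>Q\<in>insert P F. Q \<subseteq> D \<and> card Q = K \<and> (\<forall>v\<in>Q. M * card {u \<in> Q. adj v u} \<le> K)"
      proof
        fix Q assume "Q \<in> insert P F"
        then consider "Q = P" | "Q \<in> F" by blast
        then show "Q \<subseteq> D \<and> card Q = K \<and> (\<forall>v\<in>Q. M * card {u \<in> Q. adj v u} \<le> K)"
          using P(1,2) indep F(3) by cases blast+
      qed
      moreover have "finite (insert P F)" using F(1) by simp
      ultimately show ?thesis by (intro exI[of _ "insert P F"] conjI)
    next
      case False
      then have deg: "card {u \<in> D. adj v u} < K" for v by (simp add: not_le)
      obtain g where g: "\<forall>v\<in>D. g v < M"
        "\<And>v. v \<in> D \<Longrightarrow> M * card {u \<in> D. adj v u \<and> g u = g v} \<le> card {u \<in> D. adj v u}"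
        using balanced_partition[OF psubset.prems \<open>M > 0\<close>] by blast
      have "\<forall>j. \<exists>F. finite F \<and> pairwise disjnt F \<and> (\<forall>P\<in>F. P \<subseteq> {v \<in> D. g v = j} \<and> card P = K)
         \<and> card ({v \<in> D. g v = j} - \<Union>F) < K"
        using psubset.hyps \<open>K > 0\<close> by (intro allI split_into_pieces) auto
      from choice[OF this] obtain F where F: "\<And>j. finite (F j)" "\<And>j. pairwise disjnt (F j)"
        "\<And>j P. P \<in> F j \<Longrightarrow> P \<subseteq> {v \<in> D. g v = j} \<and> card P = K"
        "\<And>j. card ({v \<in> D. g v = j} - \<Union>(F j)) < K" by blast
      let ?F = "\<Union>j<M. F j"
      have "pairwise disjnt ?F"
      proof (rule pairwiseI)
        fix P Q assume "P \<in> ?F" "Q \<in> ?F" "P \<noteq> Q"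
        then obtain i j where "P \<in> F i" "Q \<in> F j" by auto
        then show "disjnt P Q"
          using F(2)[of i] F(3)[of P i] F(3)[of Q j] \<open>P \<noteq> Q\<close>
          by (cases "i = j") (auto simp: pairwise_def disjnt_def)
      qed
      moreover have "\<forall>P\<in>?F. P \<subseteq> D \<and> card P = K \<and> (\<forall>v\<in>P. M * card {u \<in> P. adj v u} \<le> K)"
      proof
        fix P assume "P \<in> ?F"
        then obtain j where P: "P \<subseteq> {v \<in> D. g v = j}" "card P = K" using F(3) by blast
        have "M * card {u \<in> P. adj v u} \<le> K" if "v \<in> P" for v
        proof -
          have "card {u \<in> P. adj v u} \<le> card {u \<in> D. adj v u \<and> g u = g v}"
            using P that psubset.hyps by (intro card_mono) auto
          then have "M * card {u \<in> P. adj v u} \<le> M * card {u \<in> D. adj v u \<and> g u = g v}"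
            by simp
          also have "\<dots> \<le> card {u \<in> D. adj v u}" using g(2) P that by blast
          finally show ?thesis using deg[of v] by simp
        qed
        then show "P \<subseteq> D \<and> card P = K \<and> (\<forall>v\<in>P. M * card {u \<in> P. adj v u} \<le> K)"
          using P by blast
      qed
      \<comment> \<open>Each of the \<open>M\<close> classes leaves fewer than \<open>K\<close>
        vertices over.\<close>
      moreover have "card (D - \<Union>?F) \<le> M * K"
      proof -
        have "D - \<Union>?F \<subseteq> (\<Union>j<M. {v \<in> D. g v = j} - \<Union>(F j))" using g(1) by auto
        then have "card (D - \<Union>?F) \<le> card (\<Union>j<M. {v \<in> D. g v = j} - \<Union>(F j))"
          using psubset.hyps by (intro card_mono) auto
        also have "\<dots> \<le> (\<Sum>j<M. card ({v \<in> D. g v = j} - \<Union>(F j)))" by (intro card_UN_le) auto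
        also have "\<dots> \<le> (\<Sum>j<M. K)" using F(4) by (intro sum_mono less_imp_le) auto
        finally show ?thesis by simp
      qed
      moreover have "finite ?F" using F(1) by simp
      ultimately show ?thesis by (intro exI[of _ ?F] conjI)
    qed
  qed
qed

end

section \<open>Host graphs of small degree\<close>

text \<open>With \<open>S \<inter> {..<r}\<close> fixed, \<open>S\<close> is determined by its part
  in \<open>{r..<n}\<close>.\<close>

lemma card_cell_le:
  assumes "r \<le> n"
  shows "card {S \<in> Pow {..<n}. S \<inter> {..<r} = c} \<le> 2 ^ (n - r)"
proof -
  have "inj_on (\<lambda>S. S \<inter> {r..<n}) {S \<in> Pow {..<n}. S \<inter> {..<r} = c}"
  proof (rule inj_onI)
    fix S S' assume "S \<in> {S \<in> Pow {..<n}. S \<inter> {..<r} = c}" "S' \<in> {S \<in> Pow {..<n}. S \<inter> {..<r} = c}"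
      and eq: "S \<inter> {r..<n} = S' \<inter> {r..<n}"
    then have S: "S \<subseteq> {..<n}" "S' \<subseteq> {..<n}" "S \<inter> {..<r} = S' \<inter> {..<r}" by auto
    have "{..<n} = {..<r} \<union> {r..<n}" using assms by auto
    then show "S = S'" using S eq by blast
  qed
  then have "card {S \<in> Pow {..<n}. S \<inter> {..<r} = c} \<le> card (Pow {r..<n})"
    by (rule card_inj_on_le) auto
  then show ?thesis by (simp add: card_Pow)
qed

text \<open>Double counting of the related pairs in \<open>A \<times> B\<close>.\<close>

lemma sum_card_swap:
  assumes "finite A" "finite B"
  shows "(\<Sum>v\<in>A. card {u \<in> B. R v u}) = (\<Sum>u\<in>B. card {v \<in> A. R v u})"
proof -
  have "(\<Sum>v\<in>A. card {u \<in> B. R v u}) = (\<Sum>v\<in>A. \<Sum>u\<in>B. if R v u then 1 else 0)"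
    using assms by (simp add: sum.If_cases Int_def conj_commute)
  also have "\<dots> = (\<Sum>u\<in>B. \<Sum>v\<in>A. if R v u then 1 else 0)" by (rule sum.swap)
  also have "\<dots> = (\<Sum>u\<in>B. card {v \<in> A. R v u})"
    using assms by (simp add: sum.If_cases Int_def conj_commute)
  finally show ?thesis .
qed

context triangle_free
begin

text \<open>
  The cells \<open>S \<inter> {..<r}\<close> receive pieces one by one, so that few vertices of a new piece have more than
  \<open>\<tau>\<close> neighbours in the piece of an earlier adjacent cell. These vertices are discarded, and the cells
  are then filled in the reverse order.
\<close>

lemma embed_low_degree:
  fixes n r K K1 D \<tau> \<Delta> :: nat
  assumes finF: "finite F" and disF: "pairwise disjnt F"
    and F: "\<And>P. P \<in> F \<Longrightarrow> P \<subseteq> V \<and> K1 \<le> card P \<and> card P \<le> K"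
    and inner: "\<And>P v. P \<in> F \<Longrightarrow> v \<in> P \<Longrightarrow> card {u \<in> P. adj v u} \<le> \<Delta>"
    and deg: "\<And>v. v \<in> \<Union>F \<Longrightarrow> card {u \<in> \<Union>F. adj v u} \<le> D"
    and "r \<le> n"
    and many: "2 ^ r + r * (K * D div (\<tau> + 1)\<^sup>2) \<le> card F"
    and room: "2 ^ (n - r) + n * \<Delta> + 2 * r * \<tau> < K1"
  shows "cube_embeds n"
proof -
  define W where "W = \<Union>F"
  have finW: "finite W" and finP: "\<And>P. P \<in> F \<Longrightarrow> finite P"
    using finF F finite_V by (auto simp: W_def intro: finite_subset)
  define bad where "bad P = {v \<in> W. \<tau> < card {u \<in> P. adj v u}}" for P
  have finbad: "finite (bad P)" for P using finW by (auto simp: bad_def)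
  \<comment> \<open>The edges between \<open>bad P\<close> and \<open>P\<close> are counted from
    both ends: more than \<open>\<tau>\<close> at each bad vertex, at most \<open>D\<close> at each
    of the at most \<open>K\<close> vertices of \<open>P\<close>.\<close>
  have card_bad: "(\<tau> + 1) * card (bad P) \<le> K * D" if "P \<in> F" for P
  proof -
    have "(\<tau> + 1) * card (bad P) = (\<Sum>v\<in>bad P. \<tau> + 1)" by simp
    also have "\<dots> \<le> (\<Sum>v\<in>bad P. card {u \<in> P. adj v u})"
      by (intro sum_mono) (auto simp: bad_def)
    also have "\<dots> = (\<Sum>u\<in>P. card {v \<in> bad P. adj v u})"
      by (rule sum_card_swap[OF finbad finP[OF that]])
    also have "\<dots> \<le> (\<Sum>u\<in>P. D)"
    proof (intro sum_mono)
      fix u assume "u \<in> P"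
      then have "u \<in> W" using that by (auto simp: W_def)
      have "card {v \<in> bad P. adj v u} \<le> card {v \<in> \<Union>F. adj u v}"
      proof (rule card_mono)
        show "finite {v \<in> \<Union>F. adj u v}" using finW by (simp add: W_def[symmetric])
      qed (auto simp: bad_def W_def adj_sym)
      also have "\<dots> \<le> D" using deg \<open>u \<in> W\<close> by (simp add: W_def)
      finally show "card {v \<in> bad P. adj v u} \<le> D" .
    qed
    also have "\<dots> \<le> K * D" using F[OF that] by simp
    finally show ?thesis .
  qed
  define conf where "conf P Q \<longleftrightarrow> \<tau> < card (Q \<inter> bad P)" for P Q
  \<comment> \<open>Pieces are disjoint, so each \<open>Q\<close> in conflict with \<open>P\<close>
    has more than \<open>\<tau>\<close> vertices of \<open>bad P\<close> to itself.\<close>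
  have card_conf: "card {Q \<in> F. conf P Q} \<le> K * D div (\<tau> + 1)\<^sup>2" if "P \<in> F" for P
  proof -
    have "(\<tau> + 1) * card {Q \<in> F. conf P Q} = (\<Sum>Q | Q \<in> F \<and> conf P Q. \<tau> + 1)" by simp
    also have "\<dots> \<le> (\<Sum>Q | Q \<in> F \<and> conf P Q. card (Q \<inter> bad P))"
      by (intro sum_mono) (auto simp: conf_def)
    also have "\<dots> = card (\<Union>Q \<in> {Q \<in> F. conf P Q}. Q \<inter> bad P)"
      using disF finF finP by (intro card_UN_disjoint[symmetric]) (auto simp: pairwise_def disjnt_def)
    also have "\<dots> \<le> card (bad P)" using finbad by (intro card_mono) auto
    finally have "(\<tau> + 1) * ((\<tau> + 1) * card {Q \<in> F. conf P Q}) \<le> (\<tau> + 1) * card (bad P)"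
      by (rule mult_le_mono2)
    also have "\<dots> \<le> K * D" by (rule card_bad[OF that])
    finally have "card {Q \<in> F. conf P Q} * (\<tau> + 1)\<^sup>2 \<le> K * D"
      by (simp add: power2_eq_square algebra_simps)
    then show ?thesis by (simp add: less_eq_div_iff_mult_less_eq)
  qed
  \<comment> \<open>An arbitrary linear order of the cells. Injectivity orders adjacent cells
    strictly, which decides the disjunction in \<open>\<phi>conf\<close>.\<close>
  obtain rk :: "nat set \<Rightarrow> nat" where rk: "inj_on rk (Pow {..<r})"
    using finite_imp_inj_to_nat_seg[of "Pow {..<r}"] by auto
  have "\<exists>\<phi>. inj_on \<phi> (Pow {..<r}) \<and> (\<forall>c\<in>Pow {..<r}. \<phi> c \<in> F) \<and>
    (\<forall>c\<in>Pow {..<r}. \<forall>c'\<in>Pow {..<r}. cube_adj r c c' \<longrightarrow> rk c' \<le> rk c \<and> \<not> conf (\<phi> c') (\<phi> c)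
       \<or> rk c \<le> rk c' \<and> \<not> conf (\<phi> c) (\<phi> c'))"
  \<comment> \<open>Every cell may receive any piece, so the candidate set is always
    \<open>F\<close>; this is why \<open>F \<inter> F\<close> occurs below.\<close>
  proof (rule greedy_embedding[where w = "\<lambda>_ _. K * D div (\<tau> + 1)\<^sup>2"])
    fix c :: "nat set" assume c: "c \<in> Pow {..<r}"
    have "card {c' \<in> Pow {..<r}. c' \<noteq> c \<and> F \<inter> F \<noteq> {}} \<le> card (Pow {..<r} - {c})"
      by (intro card_mono) auto
    also have "\<dots> = 2 ^ r - 1" using c by (simp add: card_Pow)
    finally have "card {c' \<in> Pow {..<r}. c' \<noteq> c \<and> F \<inter> F \<noteq> {}} + r * (K * D div (\<tau> + 1)\<^sup>2) < card F"
      using many zero_less_power[of "2 :: nat" r] by linarith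
    moreover have "(\<Sum>c' | c' \<in> Pow {..<r} \<and> cube_adj r c c'. K * D div (\<tau> + 1)\<^sup>2) = r * (K * D div (\<tau> + 1)\<^sup>2)"
      using sum_cube_nbs[of c r "\<lambda>_. K * D div (\<tau> + 1)\<^sup>2"] c by simp
    ultimately show "card {c' \<in> Pow {..<r}. c' \<noteq> c \<and> F \<inter> F \<noteq> {}}
      + (\<Sum>c' | c' \<in> Pow {..<r} \<and> cube_adj r c c'. K * D div (\<tau> + 1)\<^sup>2) < card F"
      by argo
  qed (use finF card_conf in \<open>auto simp: cube_adj_irrefl intro: cube_adj_sym\<close>)
  then obtain \<phi> where \<phi>: "inj_on \<phi> (Pow {..<r})" "\<And>c. c \<subseteq> {..<r} \<Longrightarrow> \<phi> c \<in> F"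
    and \<phi>conf: "\<And>c c'. c \<subseteq> {..<r} \<Longrightarrow> c' \<subseteq> {..<r} \<Longrightarrow> cube_adj r c c' \<Longrightarrow>
       rk c' \<le> rk c \<and> \<not> conf (\<phi> c') (\<phi> c) \<or> rk c \<le> rk c' \<and> \<not> conf (\<phi> c) (\<phi> c')"
    by auto
  have conf_later: "\<not> conf (\<phi> c') (\<phi> c)"
    if "c \<subseteq> {..<r}" "c' \<subseteq> {..<r}" "cube_adj r c c'" "rk c' \<le> rk c" for c c'
  proof -
    have "c \<noteq> c'" using that cube_adj_irrefl by blast
    then have "rk c' \<noteq> rk c" using rk that by (auto simp: inj_on_def)
    then show ?thesis using \<phi>conf[OF that(1-3)] that(4) by auto
  qed
  \<comment> \<open>A common bound on the ranks, so that \<open>R - rk c\<close> reverses the order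
    without truncation.\<close>
  obtain R where R: "\<And>c. c \<subseteq> {..<r} \<Longrightarrow> rk c \<le> R"
    using finite_nat_set_iff_bounded_le[of "rk ` Pow {..<r}"] by auto
  define cell where "cell S = S \<inter> {..<r}" for S :: "nat set"
  have cell_sub: "cell S \<subseteq> {..<r}" for S by (auto simp: cell_def)
  have cell_adj: "cube_adj r (cell S) (cell S')" if "cube_adj n S S'" "cell S \<noteq> cell S'" for S S'
  proof -
    from that obtain j where "j < n" "S' = flip j S" by (auto simp: cube_adj_def)
    with that(2) have "j < r \<and> cell S' = flip j (cell S)" by (auto simp: cell_def flip_def)
    then show ?thesis by (auto simp: cube_adj_def)
  qed
  define early where "early c = {c'. c' \<subseteq> {..<r} \<and> cube_adj r c c' \<and> rk c' \<le> rk c}" for c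
  have early: "finite (early c) \<and> card (early c) \<le> r" for c
  proof -
    have sub: "early c \<subseteq> (\<lambda>j. flip j c) ` {..<r}" by (auto simp: early_def cube_adj_def)
    then have "card (early c) \<le> card ((\<lambda>j. flip j c) ` {..<r})" by (intro card_mono) auto
    also have "\<dots> \<le> r" using card_image_le[of "{..<r}"] by simp
    finally have "card (early c) \<le> r" .
    moreover have "finite (early c)" by (rule finite_subset[OF sub]) simp
    ultimately show ?thesis by simp
  qed
  \<comment> \<open>Removed are the vertices with too many neighbours in the piece of an adjacent
    cell of lower rank. Such a cell is filled later, and an embedded neighbour then forbids at most
    \<open>\<tau>\<close> places in it.\<close>
  define cand where "cand S = \<phi> (cell S) - (\<Union>c' \<in> early (cell S). bad (\<phi> c'))" for S
  have cand_sub: "cand S \<subseteq> \<phi> (cell S)" for S by (auto simp: cand_def)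
  have \<phi>_cell: "\<phi> (cell S) \<in> F" for S using \<phi>(2) cell_sub by blast
  have card_cand: "K1 \<le> card (cand S) + r * \<tau>" for S
  proof -
    let ?U = "\<Union>c' \<in> early (cell S). \<phi> (cell S) \<inter> bad (\<phi> c')"
    have "card ?U \<le> (\<Sum>c' \<in> early (cell S). card (\<phi> (cell S) \<inter> bad (\<phi> c')))"
      using early by (intro card_UN_le) auto
    also have "\<dots> \<le> (\<Sum>c' \<in> early (cell S). \<tau>)"
    proof (intro sum_mono)
      fix c' assume "c' \<in> early (cell S)"
      then have "\<not> conf (\<phi> c') (\<phi> (cell S))"
        using conf_later cell_sub by (auto simp: early_def)
      then show "card (\<phi> (cell S) \<inter> bad (\<phi> c')) \<le> \<tau>" by (simp add: conf_def)
    qed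
    also have "\<dots> \<le> r * \<tau>" using early by simp
    finally have "card ?U \<le> r * \<tau>" .
    moreover have "\<phi> (cell S) - ?U = cand S" by (auto simp: cand_def)
    moreover have "card (\<phi> (cell S)) - card ?U \<le> card (\<phi> (cell S) - ?U)"
      using early finbad by (intro diff_card_le_card_Diff) auto
    moreover have "K1 \<le> card (\<phi> (cell S))" using F[OF \<phi>_cell] by simp
    ultimately show ?thesis by simp
  qed
  define w where "w S S' = (if cell S = cell S' then \<Delta> else \<tau>)" for S S'
  have "\<exists>f. inj_on f (Pow {..<n}) \<and> (\<forall>S\<in>Pow {..<n}. f S \<in> cand S) \<and>
    (\<forall>S\<in>Pow {..<n}. \<forall>S'\<in>Pow {..<n}. cube_adj n S S' \<longrightarrow> R - rk (cell S') \<le> R - rk (cell S) \<and> \<not> adj (f S') (f S)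
       \<or> R - rk (cell S) \<le> R - rk (cell S') \<and> \<not> adj (f S) (f S'))"
  proof (rule greedy_embedding[where w = w])
    show "finite (Pow {..<n})" by simp
    show "cube_adj n S' S" if "cube_adj n S S'" for S S' using that by (rule cube_adj_sym)
    show "\<not> cube_adj n S S" for S by (rule cube_adj_irrefl)
    show "finite (cand S)" for S
      using finP \<phi>_cell by (auto simp: cand_def)
    show "card {u \<in> cand S. adj v u} \<le> w S S'"
      if "cube_adj n S S'" "R - rk (cell S') \<le> R - rk (cell S)" "v \<in> cand S'" for S S' v
    proof (cases "cell S = cell S'")
      case True
      have "v \<in> \<phi> (cell S)" using that(3) cand_sub[of S'] True by auto
      have "card {u \<in> cand S. adj v u} \<le> card {u \<in> \<phi> (cell S). adj v u}"
        using cand_sub finP[OF \<phi>_cell] by (intro card_mono) auto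
      also have "\<dots> \<le> \<Delta>" by (rule inner[OF \<phi>_cell \<open>v \<in> \<phi> (cell S)\<close>])
      finally show ?thesis using True by (simp add: w_def)
    next
      case False
      have "rk (cell S) \<le> rk (cell S')"
        using that(2) R[OF cell_sub[of S]] R[OF cell_sub[of S']] by linarith
      then have "cell S \<in> early (cell S')"
        using cell_adj[OF that(1) False] cell_sub by (auto simp: early_def intro: cube_adj_sym)
      then have "v \<notin> bad (\<phi> (cell S))" using that(3) by (auto simp: cand_def)
      moreover have "v \<in> W" using that(3) cand_sub \<phi>_cell by (auto simp: W_def)
      ultimately have "card {u \<in> \<phi> (cell S). adj v u} \<le> \<tau>" by (simp add: bad_def)
      moreover have "card {u \<in> cand S. adj v u} \<le> card {u \<in> \<phi> (cell S). adj v u}"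
        using cand_sub finP[OF \<phi>_cell] by (intro card_mono) auto
      ultimately show ?thesis using False by (simp add: w_def)
    qed
    show "card {S' \<in> Pow {..<n}. S' \<noteq> S \<and> cand S' \<inter> cand S \<noteq> {}}
      + (\<Sum>S' | S' \<in> Pow {..<n} \<and> cube_adj n S S'. w S S') < card (cand S)"
      if S: "S \<in> Pow {..<n}" for S
    proof -
      have "cell S' = cell S" if "cand S' \<inter> cand S \<noteq> {}" for S'
      proof (rule ccontr)
        assume "cell S' \<noteq> cell S"
        then have "\<phi> (cell S') \<noteq> \<phi> (cell S)" using \<phi>(1) cell_sub by (auto simp: inj_on_def)
        then have "disjnt (\<phi> (cell S')) (\<phi> (cell S))" using disF \<phi>_cell by (auto simp: pairwise_def)
        then show False using that cand_sub by (auto simp: disjnt_def)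
      qed
      then have "card {S' \<in> Pow {..<n}. S' \<noteq> S \<and> cand S' \<inter> cand S \<noteq> {}}
          \<le> card {S' \<in> Pow {..<n}. S' \<inter> {..<r} = cell S}"
        by (intro card_mono) (auto simp: cell_def)
      also have "\<dots> \<le> 2 ^ (n - r)" by (rule card_cell_le[OF \<open>r \<le> n\<close>])
      finally have 1: "card {S' \<in> Pow {..<n}. S' \<noteq> S \<and> cand S' \<inter> cand S \<noteq> {}} \<le> 2 ^ (n - r)" .
      have "(\<Sum>S' | S' \<in> Pow {..<n} \<and> cube_adj n S S'. w S S') = (\<Sum>j<n. w S (flip j S))"
        using S by (intro sum_cube_nbs) auto
      also have "\<dots> \<le> (\<Sum>j<n. \<Delta> + (if j < r then \<tau> else 0))"
        by (intro sum_mono) (auto simp: w_def cell_def flip_def)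
      also have "\<dots> = n * \<Delta> + r * \<tau>"
      proof -
        have "{..<n} \<inter> {j. j < r} = {..<r}" using \<open>r \<le> n\<close> by auto
        then show ?thesis by (simp add: sum.distrib sum.If_cases)
      qed
      finally show ?thesis using 1 card_cand[of S] room by linarith
    qed
  qed
  then obtain f where f: "inj_on f (Pow {..<n})" "\<forall>S\<in>Pow {..<n}. f S \<in> cand S"
    "\<forall>S\<in>Pow {..<n}. \<forall>S'\<in>Pow {..<n}. cube_adj n S S' \<longrightarrow> \<not> adj (f S') (f S) \<or> \<not> adj (f S) (f S')"
    by blast
  show ?thesis
    unfolding cube_embeds_def
  proof (intro exI[of _ f] conjI)
    show "f ` Pow {..<n} \<subseteq> V" using f(2) cand_sub \<phi>_cell F by blast
    show "\<forall>S\<in>Pow {..<n}. \<forall>S'\<in>Pow {..<n}. cube_adj n S S' \<longrightarrow> \<not> adj (f S) (f S')"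
      using f(3) adj_sym by blast
  qed (rule f(1))
qed

end

section \<open>Majority bits of a subset\<close>

text \<open>
  A subset of \<open>{..<n}\<close> is cut into \<open>r\<close> blocks of odd length \<open>k = 2 * h + 1\<close>; \<open>bits\<close> records on which
  blocks it has a majority. Sets with different bits can only be joined through sets that have
  \<open>h\<close> or \<open>h + 1\<close> elements in some block, and these are rare.
\<close>

definition blk :: "nat \<Rightarrow> nat \<Rightarrow> nat set" where
  "blk k i = {i * k..<Suc i * k}"

definition bits :: "nat \<Rightarrow> nat \<Rightarrow> nat \<Rightarrow> nat set \<Rightarrow> nat set" where
  "bits h k r S = {i. i < r \<and> h < card (S \<inter> blk k i)}"

lemma finite_blk [simp]: "finite (blk k i)" by (simp add: blk_def)

lemma card_blk [simp]: "card (blk k i) = k" by (simp add: blk_def)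

lemma blk_disjoint: "j \<in> blk k i \<Longrightarrow> j \<in> blk k i' \<Longrightarrow> i = i'"
  unfolding blk_def
  by (metis atLeastLessThan_iff div_nat_eqI mult.commute)

lemma blk_less: "j \<in> blk k i \<Longrightarrow> i < r \<Longrightarrow> j < r * k"
  unfolding blk_def
  by (metis Suc_leI atLeastLessThan_iff less_le_trans mult_le_mono1)

lemma ex_blk: "j < r * k \<Longrightarrow> \<exists>i<r. j \<in> blk k i"
proof (rule exI[of _ "j div k"])
  assume j: "j < r * k"
  then have "k > 0" by (cases k) auto
  then have "j div k < r" using j by (simp add: less_mult_imp_div_less)
  moreover have "j div k * k \<le> j" by simp
  moreover have "j < Suc (j div k) * k" using \<open>k > 0\<close> dividend_less_div_times by simp
  ultimately show "j div k < r \<and> j \<in> blk k (j div k)" by (simp add: blk_def)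
qed

lemma card_flip_blk:
  assumes "j \<in> blk k i"
  shows "card (flip j S \<inter> blk k i) = Suc (card (S \<inter> blk k i)) \<or>
    card (S \<inter> blk k i) = Suc (card (flip j S \<inter> blk k i))"
proof (cases "j \<in> S")
  case True
  then have "S \<inter> blk k i = insert j (flip j S \<inter> blk k i)" using assms by (auto simp: flip_def)
  moreover have "j \<notin> flip j S" using True by (simp add: flip_def)
  ultimately show ?thesis by simp
next
  case False
  then have "flip j S \<inter> blk k i = insert j (S \<inter> blk k i)" using assms by (auto simp: flip_def)
  then show ?thesis using False by simp
qed

lemma flip_blk: "j \<notin> blk k i \<Longrightarrow> flip j S \<inter> blk k i = S \<inter> blk k i"
  by (auto simp: flip_def)

text \<open>Complementation exchanges the two families because \<open>card X\<close> is odd.\<close>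

lemma card_half:
  assumes "finite X" "card X = 2 * h + 1"
  shows "card {Y \<in> Pow X. card Y \<le> h} = 2 ^ (2 * h)" "card {Y \<in> Pow X. h < card Y} = 2 ^ (2 * h)"
proof -
  let ?lo = "{Y \<in> Pow X. card Y \<le> h}" and ?hi = "{Y \<in> Pow X. h < card Y}"
  have "bij_betw (\<lambda>Y. X - Y) ?lo ?hi"
  proof (rule bij_betw_byWitness[where f' = "\<lambda>Y. X - Y"])
    have c: "card (X - Y) = 2 * h + 1 - card Y" if "Y \<subseteq> X" for Y
      using that assms by (simp add: card_Diff_subset finite_subset)
    show "(\<lambda>Y. X - Y) ` ?lo \<subseteq> ?hi" using c by auto
    show "(\<lambda>Y. X - Y) ` ?hi \<subseteq> ?lo" using c by auto
  qed auto
  then have eq: "card ?lo = card ?hi" by (rule bij_betw_same_card)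
  have "card ?lo + card ?hi = card (?lo \<union> ?hi)"
    using assms by (intro card_Un_disjoint[symmetric]) auto
  also have "?lo \<union> ?hi = Pow X" by auto
  finally have "card ?lo + card ?hi = 2 ^ (2 * h + 1)" using assms by (simp add: card_Pow)
  with eq show "card ?lo = 2 ^ (2 * h)" "card ?hi = 2 ^ (2 * h)" by simp_all
qed

text \<open>A set is determined by its traces on the blocks, on the window
  \<open>{r * k..<r * k + s}\<close> and on the coordinates beyond. The window trace is fixed; the
  others are counted independently.\<close>

lemma card_block_product:
  assumes \<Y>: "\<And>i. i < r \<Longrightarrow> \<Y> i \<subseteq> Pow (blk k i)" and "r * k + s \<le> n"
  shows "card {S \<in> Pow {..<n}. (\<forall>i<r. S \<inter> blk k i \<in> \<Y> i) \<and> S \<inter> {r * k..<r * k + s} = x}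
    \<le> (\<Prod>i<r. card (\<Y> i)) * 2 ^ (n - (r * k + s))"
proof -
  let ?X = "{S \<in> Pow {..<n}. (\<forall>i<r. S \<inter> blk k i \<in> \<Y> i) \<and> S \<inter> {r * k..<r * k + s} = x}"
  let ?g = "\<lambda>S. (\<lambda>i\<in>{..<r}. S \<inter> blk k i, S \<inter> {r * k + s..<n})"
  have "inj_on ?g ?X"
  proof (rule inj_onI)
    fix S S' assume S: "S \<in> ?X" "S' \<in> ?X" and eq: "?g S = ?g S'"
    have b: "S \<inter> blk k i = S' \<inter> blk k i" if "i < r" for i
      using eq that by (metis (no_types, lifting) Pair_inject lessThan_iff restrict_apply')
    have "j \<in> S \<longleftrightarrow> j \<in> S'" if j: "j < n" for j
    proof -
      consider "j < r * k" | "j \<in> {r * k..<r * k + s}" | "j \<in> {r * k + s..<n}" using j by fastforce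
      then show ?thesis
      proof cases
        case 1
        then obtain i where "i < r" "j \<in> blk k i" using ex_blk by blast
        then show ?thesis using b by blast
      next
        case 2
        then show ?thesis using S by blast
      next
        case 3
        then show ?thesis using eq by blast
      qed
    qed
    then show "S = S'" using S by blast
  qed
  moreover have "?g ` ?X \<subseteq> (\<Pi>\<^sub>E i\<in>{..<r}. \<Y> i) \<times> Pow {r * k + s..<n}" by auto
  moreover have finY: "finite (\<Y> i)" if "i < r" for i
    using \<Y>[OF that] finite_subset by fastforce
  then have "finite ((\<Pi>\<^sub>E i\<in>{..<r}. \<Y> i) \<times> Pow {r * k + s..<n})"
    by (intro finite_cartesian_product finite_PiE) auto
  ultimately have "card ?X \<le> card ((\<Pi>\<^sub>E i\<in>{..<r}. \<Y> i) \<times> Pow {r * k + s..<n})"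
    by (rule card_inj_on_le)
  also have "\<dots> = (\<Prod>i<r. card (\<Y> i)) * 2 ^ (n - (r * k + s))"
    by (simp add: card_cartesian_product card_PiE card_Pow)
  finally show ?thesis .
qed

text \<open>The possible traces on block \<open>i\<close> of a set with bits \<open>b\<close>; odd
  block length makes both sides equally large.\<close>

definition side :: "nat \<Rightarrow> nat \<Rightarrow> nat set \<Rightarrow> nat \<Rightarrow> nat set set" where
  "side h k b i = {Y \<in> Pow (blk k i). h < card Y \<longleftrightarrow> i \<in> b}"

lemma card_side: "card (side h (2 * h + 1) b i) = 2 ^ (2 * h)"
  using card_half[of "blk (2 * h + 1) i" h]
  by (cases "i \<in> b") (simp_all add: side_def not_less)

lemma bits_side: "bits h k r S = b \<Longrightarrow> i < r \<Longrightarrow> S \<inter> blk k i \<in> side h k b i"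
  by (auto simp: bits_def side_def)

text \<open>The majority bits are fair and independent, so each of the \<open>r\<close> blocks
  halves the number of sets.\<close>

lemma card_bits_le:
  assumes "r * (2 * h + 1) \<le> n"
  shows "card {S \<in> Pow {..<n}. bits h (2 * h + 1) r S = b} \<le> 2 ^ (n - r)"
proof -
  let ?k = "2 * h + 1"
  have "card {S \<in> Pow {..<n}. bits h ?k r S = b}
    \<le> card {S \<in> Pow {..<n}. (\<forall>i<r. S \<inter> blk ?k i \<in> side h ?k b i) \<and> S \<inter> {r * ?k..<r * ?k + 0} = {}}"
    using bits_side by (intro card_mono) auto
  also have "\<dots> \<le> (\<Prod>i<r. card (side h ?k b i)) * 2 ^ (n - (r * ?k + 0))"
    using assms by (intro card_block_product) (auto simp: side_def)
  also have "\<dots> = (2 ^ (2 * h)) ^ r * 2 ^ (n - r * ?k)" by (simp only: card_side prod_constant card_lessThan add_0_right)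
  also have "\<dots> = 2 ^ (n - r)"
  proof -
    have "2 * h * r + (n - r * ?k) = n - r" using assms by (simp add: algebra_simps)
    then show ?thesis by (metis power_add power_mult)
  qed
  finally show ?thesis .
qed

text \<open>Union bound over the block \<open>i0\<close> with a critical count. As
  \<open>m0 \<le> h < m1\<close>, the bit of \<open>i0\<close> decides which count occurs, so this
  block contributes one binomial coefficient and every other block half of its subsets.\<close>

lemma card_critical_le:
  assumes "r * (2 * h + 1) + s \<le> n" and m: "m0 \<le> h" "h < m1"
    and B: "(2 * h + 1) choose m0 \<le> B" "(2 * h + 1) choose m1 \<le> B"
  shows "card {S \<in> Pow {..<n}. (\<exists>i<r. card (S \<inter> blk (2 * h + 1) i) \<in> {m0, m1}) \<and>
      bits h (2 * h + 1) r S = b \<and> S \<inter> {r * (2 * h + 1)..<r * (2 * h + 1) + s} = x}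
    \<le> r * (B * 2 ^ (2 * h * (r - 1)) * 2 ^ (n - (r * (2 * h + 1) + s)))"
proof -
  let ?k = "2 * h + 1"
  define Z where "Z i = {Y \<in> Pow (blk ?k i). card Y = (if i \<in> b then m1 else m0)}" for i
  define \<Y> where "\<Y> i0 = (side h ?k b)(i0 := Z i0)" for i0
  define X where "X i0 = {S \<in> Pow {..<n}. (\<forall>i<r. S \<inter> blk ?k i \<in> \<Y> i0 i) \<and>
     S \<inter> {r * ?k..<r * ?k + s} = x}" for i0
  have Z: "card (Z i) \<le> B" for i
    using n_subsets[of "blk ?k i" "if i \<in> b then m1 else m0"] B by (simp add: Z_def)
  have X: "card (X i0) \<le> B * 2 ^ (2 * h * (r - 1)) * 2 ^ (n - (r * ?k + s))" if "i0 < r" for i0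
  proof -
    have "card (X i0) \<le> (\<Prod>i<r. card (\<Y> i0 i)) * 2 ^ (n - (r * ?k + s))"
      unfolding X_def using assms(1)
      by (intro card_block_product) (auto simp: \<Y>_def Z_def side_def)
    also have "(\<Prod>i<r. card (\<Y> i0 i)) = card (\<Y> i0 i0) * (\<Prod>i\<in>{..<r} - {i0}. card (\<Y> i0 i))"
      using that by (intro prod.remove) auto
    also have "(\<Prod>i\<in>{..<r} - {i0}. card (\<Y> i0 i)) = (\<Prod>i\<in>{..<r} - {i0}. 2 ^ (2 * h))"
      using card_side by (intro prod.cong) (auto simp: \<Y>_def)
    also have "\<dots> = 2 ^ (2 * h * (r - 1))" using that by (simp add: power_mult)
    also have "card (\<Y> i0 i0) = card (Z i0)" by (simp add: \<Y>_def)
    also have "card (Z i0) * 2 ^ (2 * h * (r - 1)) * 2 ^ (n - (r * ?k + s))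
      \<le> B * 2 ^ (2 * h * (r - 1)) * 2 ^ (n - (r * ?k + s))"
      using Z by (intro mult_le_mono1)
    finally show ?thesis .
  qed
  have "{S \<in> Pow {..<n}. (\<exists>i<r. card (S \<inter> blk ?k i) \<in> {m0, m1}) \<and>
      bits h ?k r S = b \<and> S \<inter> {r * ?k..<r * ?k + s} = x} \<subseteq> (\<Union>i0<r. X i0)"
  proof
    fix S assume "S \<in> {S \<in> Pow {..<n}. (\<exists>i<r. card (S \<inter> blk ?k i) \<in> {m0, m1}) \<and>
      bits h ?k r S = b \<and> S \<inter> {r * ?k..<r * ?k + s} = x}"
    then obtain i0 where S: "S \<in> Pow {..<n}" "bits h ?k r S = b" "S \<inter> {r * ?k..<r * ?k + s} = x"
      and i0: "i0 < r" "card (S \<inter> blk ?k i0) \<in> {m0, m1}" by auto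
    have "i0 \<in> b \<longleftrightarrow> h < card (S \<inter> blk ?k i0)" using S(2) i0(1) by (auto simp: bits_def)
    then have "S \<inter> blk ?k i0 \<in> Z i0" using i0(2) m by (auto simp: Z_def)
    then have "S \<in> X i0" using S bits_side[OF S(2)] by (auto simp: X_def \<Y>_def)
    then show "S \<in> (\<Union>i0<r. X i0)" using i0(1) by blast
  qed
  then have "card {S \<in> Pow {..<n}. (\<exists>i<r. card (S \<inter> blk ?k i) \<in> {m0, m1}) \<and>
      bits h ?k r S = b \<and> S \<inter> {r * ?k..<r * ?k + s} = x} \<le> card (\<Union>i0<r. X i0)"
    by (rule card_mono[rotated]) (auto simp: X_def)
  also have "\<dots> \<le> (\<Sum>i0<r. card (X i0))" by (intro card_UN_le) auto
  also have "\<dots> \<le> (\<Sum>i0<r. B * 2 ^ (2 * h * (r - 1)) * 2 ^ (n - (r * ?k + s)))"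
    using X by (intro sum_mono) auto
  finally show ?thesis by simp
qed

section \<open>Embedding around an independent centre\<close>

context triangle_free
begin

text \<open>
  Sets with \<open>h\<close> or \<open>h + 1\<close> elements in some block (the shell) go to the centre \<open>C\<close>, all others to the
  piece given by their bits. Only shell vertices and vertices with \<open>h - 1\<close> or \<open>h + 2\<close> elements in some
  block are adjacent across the two kinds, and then they agree in their bits and in the coordinates
  from \<open>X\<close>; so they can be placed in the sparse pair \<open>(A b x, B b x)\<close>.
\<close>

lemma embed_star:
  fixes n r h s L \<Delta> :: nat and P :: "nat set \<Rightarrow> 'a set" and A B :: "nat set \<Rightarrow> nat set \<Rightarrow> 'a set"
  defines "k \<equiv> 2 * h + 1"
  defines "X \<equiv> {r * k..<r * k + s}"
  assumes "1 \<le> h" and len: "r * k + s \<le> n"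
    and PV: "\<And>b. b \<subseteq> {..<r} \<Longrightarrow> P b \<subseteq> V - C" and CV: "C \<subseteq> V"
    and disP: "\<And>b b'. b \<subseteq> {..<r} \<Longrightarrow> b' \<subseteq> {..<r} \<Longrightarrow> b \<noteq> b' \<Longrightarrow> P b \<inter> P b' = {}"
    and indep: "\<And>u v. u \<in> C \<Longrightarrow> v \<in> C \<Longrightarrow> \<not> adj u v"
    and inner: "\<And>b v. b \<subseteq> {..<r} \<Longrightarrow> v \<in> P b \<Longrightarrow> card {u \<in> P b. adj v u} \<le> \<Delta>"
    and AP: "\<And>b x. b \<subseteq> {..<r} \<Longrightarrow> x \<subseteq> X \<Longrightarrow> A b x \<subseteq> P b \<and> card (A b x) = L"
    and BC: "\<And>b x. b \<subseteq> {..<r} \<Longrightarrow> x \<subseteq> X \<Longrightarrow> B b x \<subseteq> C \<and> card (B b x) = L"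
    and disA: "\<And>b x x'. b \<subseteq> {..<r} \<Longrightarrow> x \<subseteq> X \<Longrightarrow> x' \<subseteq> X \<Longrightarrow> x \<noteq> x' \<Longrightarrow> A b x \<inter> A b x' = {}"
    and disB: "\<And>b b' x x'. b \<subseteq> {..<r} \<Longrightarrow> b' \<subseteq> {..<r} \<Longrightarrow> x \<subseteq> X \<Longrightarrow> x' \<subseteq> X \<Longrightarrow>
      b \<noteq> b' \<or> x \<noteq> x' \<Longrightarrow> B b x \<inter> B b' x' = {}"
    and AB: "\<And>b x a. b \<subseteq> {..<r} \<Longrightarrow> x \<subseteq> X \<Longrightarrow> a \<in> A b x \<Longrightarrow> 4 * n * card {u \<in> B b x. adj a u} \<le> L"
    and L: "2 * (r * ((k choose h) * 2 ^ (2 * h * (r - 1)) * 2 ^ (n - (r * k + s)))) \<le> L"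
      "4 * n * \<Delta> \<le> L" "0 < L" "0 < n"
    and room: "\<And>b. b \<subseteq> {..<r} \<Longrightarrow> 2 ^ (n - r) + n * \<Delta> + 2 ^ s * L < card (P b)"
  shows "cube_embeds n"
proof -
  have fins: "finite C" "\<And>b. b \<subseteq> {..<r} \<Longrightarrow> finite (P b)"
    using finite_subset[OF CV finite_V] finite_subset[OF PV finite_Diff[OF finite_V]] by auto
  have finA: "finite (A b x)" and finB: "finite (B b x)" if "b \<subseteq> {..<r}" "x \<subseteq> X" for b x
    using AP[OF that] BC[OF that] fins(1) fins(2)[OF that(1)] finite_subset by metis+
  define ct where "ct S i = card (S \<inter> blk k i)" for S i
  define bt where "bt S = bits h k r S" for S
  define xt where "xt S = S \<inter> X" for S
  have bt: "bt S \<subseteq> {..<r}" and xt: "xt S \<subseteq> X" for S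
    by (auto simp: bt_def bits_def xt_def)
  define shell where "shell S \<longleftrightarrow> (\<exists>i<r. ct S i \<in> {h, h + 1})" for S
  define near where "near S \<longleftrightarrow> (\<exists>i<r. ct S i \<in> {h - 1, h + 2})" for S
  have step: "ct S' i = ct S i \<or> ct S' i = Suc (ct S i) \<or> ct S i = Suc (ct S' i)"
    if "cube_adj n S S'" for S S' i
    using that card_flip_blk[of _ k i S] flip_blk[of _ k i S]
    unfolding cube_adj_def ct_def by metis
  \<comment> \<open>A majority can change only between the counts \<open>h\<close> and
    \<open>h + 1\<close>, and both belong to the shell.\<close>
  have off_shell: "bt S = bt S'" if "cube_adj n S S'" "\<not> shell S" "\<not> shell S'" for S S'
  proof -
    have "h < ct S i \<longleftrightarrow> h < ct S' i" if "i < r" for i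
    proof -
      have "ct S i \<notin> {h, h + 1}" "ct S' i \<notin> {h, h + 1}"
        using \<open>\<not> shell S\<close> \<open>\<not> shell S'\<close> that by (auto simp: shell_def)
      then show ?thesis using step[OF \<open>cube_adj n S S'\<close>, of i] by auto
    qed
    then show ?thesis by (auto simp: bt_def bits_def ct_def)
  qed
  \<comment> \<open>Leaving the shell moves the count of block \<open>i\<close> to
    \<open>h - 1\<close> or \<open>h + 2\<close>. Hence the flipped coordinate lies in that block,
    no majority changes, and the window \<open>X\<close> beyond the blocks is untouched.\<close>
  have cross: "near S' \<and> bt S = bt S' \<and> xt S = xt S'"
    if adjS: "cube_adj n S S'" and S: "shell S" and S': "\<not> shell S'" for S S'
  proof -
    obtain j where j: "S' = flip j S" using adjS by (auto simp: cube_adj_def)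
    obtain i where i: "i < r" "ct S i \<in> {h, h + 1}" using S by (auto simp: shell_def)
    have i': "ct S' i \<notin> {h, h + 1}" using S' i(1) by (auto simp: shell_def)
    have ji: "j \<in> blk k i"
    proof (rule ccontr)
      assume "j \<notin> blk k i"
      then have "ct S' i = ct S i" unfolding ct_def j by (metis flip_blk)
      then show False using i i' by simp
    qed
    have ci: "ct S i = h \<and> ct S' i = h - 1 \<or> ct S i = h + 1 \<and> ct S' i = h + 2"
      using step[OF adjS, of i] i(2) i' by auto
    then have "near S'" using i(1) by (auto simp: near_def)
    moreover have "bt S = bt S'"
    proof -
      have "h < ct S i0 \<longleftrightarrow> h < ct S' i0" for i0
      proof (cases "i0 = i")
        case True
        then show ?thesis using ci by auto
      next
        case False
        then have "j \<notin> blk k i0" using ji blk_disjoint by blast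
        then show ?thesis by (simp add: ct_def j flip_blk)
      qed
      then show ?thesis by (auto simp: bt_def bits_def ct_def)
    qed
    moreover have "xt S = xt S'"
      using blk_less[OF ji i(1)] by (auto simp: xt_def X_def j flip_def)
    ultimately show ?thesis by blast
  qed
  \<comment> \<open>What is left of a piece for the vertices neither in the shell nor near
    it.\<close>
  define R where "R b = P b - (\<Union>x \<in> Pow X. A b x)" for b
  define cand where "cand S = (if shell S then B (bt S) (xt S)
    else if near S then A (bt S) (xt S) else R (bt S))" for S
  define w where "w S = (if shell S then L div (4 * n) else \<Delta>)" for S
  have candP: "cand S \<subseteq> P (bt S)" if "\<not> shell S" for S
    using that AP[OF bt xt] by (auto simp: cand_def R_def)
  have candC: "cand S \<subseteq> C" if "shell S" for S
    using that BC[OF bt xt] by (auto simp: cand_def)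
  have cand_fin: "finite (cand S)" for S
    using finA[OF bt xt] finB[OF bt xt] fins(2)[OF bt] by (auto simp: cand_def R_def)
  have finX: "finite X" by (simp add: X_def)
  have card_R: "card (P b) \<le> card (R b) + 2 ^ s * L" if "b \<subseteq> {..<r}" for b
  proof -
    have "card (\<Union>x \<in> Pow X. A b x) \<le> (\<Sum>x \<in> Pow X. card (A b x))"
      using finX by (intro card_UN_le) auto
    also have "\<dots> = (\<Sum>x \<in> Pow X. L)" using AP[OF that] by (intro sum.cong) auto
    also have "\<dots> = 2 ^ s * L" using finX by (simp add: card_Pow) (simp add: X_def)
    finally have "card (\<Union>x \<in> Pow X. A b x) \<le> 2 ^ s * L" .
    moreover have "card (P b) - card (\<Union>x \<in> Pow X. A b x) \<le> card (R b)"
      unfolding R_def using finA[OF that] finX by (intro diff_card_le_card_Diff) auto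
    ultimately show ?thesis by linarith
  qed
  have bin: "k choose m \<le> k choose h" for m
    using binomial_maximum[of k m] by (simp add: k_def)
  have few: "2 * card {S \<in> Pow {..<n}. (\<exists>i<r. ct S i \<in> {m0, m1}) \<and> bt S = b \<and> xt S = x} \<le> L"
    if "m0 \<le> h" "h < m1" "k choose m0 \<le> k choose h" "k choose m1 \<le> k choose h" for m0 m1 b x
    using card_critical_le[of r h s n m0 m1 "k choose h" b x] that len L(1)
    unfolding k_def X_def ct_def bt_def xt_def by linarith
  \<comment> \<open>The shell has rank 1 and comes last, so only degrees from \<open>A\<close> into
    \<open>B\<close> matter across the two kinds, and these are bounded by
    \<open>AB\<close>.\<close>
  have "\<exists>f. inj_on f (Pow {..<n}) \<and> (\<forall>S\<in>Pow {..<n}. f S \<in> cand S) \<and>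
    (\<forall>S\<in>Pow {..<n}. \<forall>S'\<in>Pow {..<n}. cube_adj n S S' \<longrightarrow>
       (if shell S' then 1 else 0) \<le> (if shell S then 1 else (0 :: nat)) \<and> \<not> adj (f S') (f S)
       \<or> (if shell S then 1 else 0) \<le> (if shell S' then 1 else (0 :: nat)) \<and> \<not> adj (f S) (f S'))"
  proof (rule greedy_embedding[where w = "\<lambda>S _. w S"])
    show "finite (Pow {..<n})" by simp
    show "cube_adj n S' S" if "cube_adj n S S'" for S S' using that by (rule cube_adj_sym)
    show "\<not> cube_adj n S S" for S by (rule cube_adj_irrefl)
    show "finite (cand S)" for S by (rule cand_fin)
    show "card {u \<in> cand S. adj v u} \<le> w S"
      if adjS: "cube_adj n S S'" and rk: "(if shell S' then 1 else 0) \<le> (if shell S then 1 else (0 :: nat))"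
        and v: "v \<in> cand S'" for S S' v
    proof (cases "shell S")
      case True
      show ?thesis
      proof (cases "shell S'")
        case True
        then have "{u \<in> cand S. adj v u} = {}"
          using v candC[OF \<open>shell S\<close>] candC[OF True] indep by blast
        then show ?thesis by (simp only: card.empty le0)
      next
        case False
        have S': "near S'" "bt S = bt S'" "xt S = xt S'"
          using cross[OF adjS \<open>shell S\<close> False] by auto
        then have "v \<in> A (bt S) (xt S)" using v False by (simp add: cand_def)
        from AB[OF bt xt this] have "card {u \<in> B (bt S) (xt S). adj v u} \<le> L div (4 * n)"
          using L(4) by (simp add: less_eq_div_iff_mult_less_eq mult.commute)
        then show ?thesis using \<open>shell S\<close> by (simp add: cand_def w_def)
      qed
    next
      case False
      then have S': "\<not> shell S'" using rk by (auto split: if_splits)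
      have eq: "bt S = bt S'" by (rule off_shell[OF adjS False S'])
      have "card {u \<in> cand S. adj v u} \<le> card {u \<in> P (bt S). adj v u}"
        using candP[OF False] fins(2)[OF bt] by (intro card_mono) auto
      also have "\<dots> \<le> \<Delta>"
      proof (rule inner[OF bt])
        show "v \<in> P (bt S)" using v candP[OF S'] eq by auto
      qed
      finally show ?thesis using False by (simp add: w_def)
    qed
    show "card {S' \<in> Pow {..<n}. S' \<noteq> S \<and> cand S' \<inter> cand S \<noteq> {}}
      + (\<Sum>S' | S' \<in> Pow {..<n} \<and> cube_adj n S S'. w S) < card (cand S)"
      if S: "S \<in> Pow {..<n}" for S
    proof -
      let ?O = "{S' \<in> Pow {..<n}. S' \<noteq> S \<and> cand S' \<inter> cand S \<noteq> {}}"
      have "(\<Sum>S' | S' \<in> Pow {..<n} \<and> cube_adj n S S'. w S) = n * w S"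
        using sum_cube_nbs[of S n "\<lambda>_. w S"] S by simp
      moreover have "card ?O + n * w S < card (cand S)"
      proof -
        consider "shell S" | "\<not> shell S" "near S" | "\<not> shell S" "\<not> near S" by blast
        then show ?thesis
        proof cases
          case 1
          have "?O \<subseteq> {S' \<in> Pow {..<n}. (\<exists>i<r. ct S' i \<in> {h, h + 1}) \<and> bt S' = bt S \<and> xt S' = xt S}"
          proof
            fix S' assume O: "S' \<in> ?O"
            then obtain y where y: "y \<in> cand S'" "y \<in> cand S" by blast
            have "shell S'" using y candC[OF 1] candP[of S'] PV[OF bt] by blast
            then have "y \<in> B (bt S') (xt S')" "y \<in> B (bt S) (xt S)"
              using y 1 by (simp_all add: cand_def)
            then have "bt S' = bt S \<and> xt S' = xt S"
              using disB[OF bt bt xt xt, of S' S S' S] by blast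
            then show "S' \<in> {S' \<in> Pow {..<n}. (\<exists>i<r. ct S' i \<in> {h, h + 1}) \<and> bt S' = bt S \<and> xt S' = xt S}"
              using \<open>shell S'\<close> O by (simp add: shell_def)
          qed
          then have "card ?O \<le> card {S' \<in> Pow {..<n}. (\<exists>i<r. ct S' i \<in> {h, h + 1}) \<and> bt S' = bt S \<and> xt S' = xt S}"
            by (intro card_mono) auto
          \<comment> \<open>Occupied places take at most half of \<open>L\<close> and neighbours at
            most a quarter.\<close>
          then have "2 * card ?O \<le> L" using few[of h "h + 1" "bt S" "xt S"] bin by simp
          moreover have "4 * (n * w S) \<le> L" using 1 by (simp add: w_def) (metis mult.assoc times_div_less_eq_dividend)
          moreover have "card (cand S) = L" using 1 BC[OF bt xt] by (simp add: cand_def)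
          ultimately show ?thesis using L(3) by linarith
        next
          case 2
          have "?O \<subseteq> {S' \<in> Pow {..<n}. (\<exists>i<r. ct S' i \<in> {h - 1, h + 2}) \<and> bt S' = bt S \<and> xt S' = xt S}"
          proof
            fix S' assume O: "S' \<in> ?O"
            then obtain y where y: "y \<in> cand S'" "y \<in> cand S" by blast
            have S': "\<not> shell S'" using y candC[of S'] candP[OF 2(1)] PV[OF bt] by blast
            have b: "bt S' = bt S" using y candP[OF S'] candP[OF 2(1)] disP[OF bt bt, of S' S] by blast
            have yA: "y \<in> A (bt S) (xt S)" using y 2 by (simp add: cand_def)
            then have near: "near S'" using y(1) S' b xt[of S] by (auto simp: cand_def R_def split: if_splits)
            then have "y \<in> A (bt S) (xt S')" using y S' b by (simp add: cand_def)
            then have "xt S' = xt S" using yA disA[OF bt xt xt] by blast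
            then show "S' \<in> {S' \<in> Pow {..<n}. (\<exists>i<r. ct S' i \<in> {h - 1, h + 2}) \<and> bt S' = bt S \<and> xt S' = xt S}"
              using near b O by (simp add: near_def)
          qed
          then have "card ?O \<le> card {S' \<in> Pow {..<n}. (\<exists>i<r. ct S' i \<in> {h - 1, h + 2}) \<and> bt S' = bt S \<and> xt S' = xt S}"
            by (intro card_mono) auto
          then have "2 * card ?O \<le> L" using few[of "h - 1" "h + 2" "bt S" "xt S"] bin by simp
          moreover have "4 * (n * w S) \<le> L" using 2 L(2) by (simp add: w_def)
          moreover have "card (cand S) = L" using 2 AP[OF bt xt] by (simp add: cand_def)
          ultimately show ?thesis using L(3) by linarith
        next
          case 3
          have "?O \<subseteq> {S' \<in> Pow {..<n}. bits h (2 * h + 1) r S' = bt S}"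
          proof
            fix S' assume O: "S' \<in> ?O"
            then obtain y where y: "y \<in> cand S'" "y \<in> cand S" by blast
            have S': "\<not> shell S'" using y candC[of S'] candP[OF 3(1)] PV[OF bt] by blast
            have "bt S' = bt S" using y candP[OF S'] candP[OF 3(1)] disP[OF bt bt, of S' S] by blast
            then show "S' \<in> {S' \<in> Pow {..<n}. bits h (2 * h + 1) r S' = bt S}"
              using O by (simp add: bt_def k_def)
          qed
          then have "card ?O \<le> card {S' \<in> Pow {..<n}. bits h (2 * h + 1) r S' = bt S}"
            by (intro card_mono) auto
          also have "\<dots> \<le> 2 ^ (n - r)" using len by (intro card_bits_le) (simp add: k_def)
          finally have "card ?O \<le> 2 ^ (n - r)" .
          moreover have "w S = \<Delta>" using 3 by (simp add: w_def)
          moreover have "cand S = R (bt S)" using 3 by (simp add: cand_def)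
          ultimately show ?thesis using room[OF bt[of S]] card_R[OF bt[of S]] by simp
        qed
      qed
      ultimately show ?thesis by argo
    qed
  qed
  then obtain f where f: "inj_on f (Pow {..<n})" "\<forall>S\<in>Pow {..<n}. f S \<in> cand S"
    "\<forall>S\<in>Pow {..<n}. \<forall>S'\<in>Pow {..<n}. cube_adj n S S' \<longrightarrow> \<not> adj (f S') (f S) \<or> \<not> adj (f S) (f S')"
    by blast
  show ?thesis
    unfolding cube_embeds_def
  proof (intro exI[of _ f] conjI)
    have "cand S \<subseteq> V" for S using candP[of S] candC[of S] PV[OF bt] CV by blast
    then show "f ` Pow {..<n} \<subseteq> V" using f(2) by blast
    show "\<forall>S\<in>Pow {..<n}. \<forall>S'\<in>Pow {..<n}. cube_adj n S S' \<longrightarrow> \<not> adj (f S) (f S')"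
      using f(3) adj_sym by blast
  qed (rule f(1))
qed


section \<open>Linked sets and disjoint sparse pairs\<close>

text \<open>The condition is one-sided: \<open>A\<close> is the side in a piece, filled first, and
  \<open>B\<close> the side in the centre. The factor \<open>4 * n\<close> lets \<open>n\<close>
  neighbours together forbid at most a quarter of \<open>B\<close>.\<close>

definition sparse_pair :: "nat \<Rightarrow> nat \<Rightarrow> 'a set \<Rightarrow> 'a set \<Rightarrow> bool" where
  "sparse_pair n L A B \<longleftrightarrow> card A = L \<and> card B = L \<and> (\<forall>a\<in>A. 4 * n * card {u \<in> B. adj a u} \<le> L)"

text \<open>
  The set \<open>X\<close> makes the notion robust: many disjoint sparse pairs can be found one after the other.
\<close>

definition linked :: "nat \<Rightarrow> nat \<Rightarrow> nat \<Rightarrow> nat \<Rightarrow> 'a set \<Rightarrow> 'a set \<Rightarrow> bool" where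
  "linked n L \<rho>1 \<rho>2 P C \<longleftrightarrow> (\<forall>X. card (X \<inter> P) \<le> \<rho>1 \<longrightarrow> card (X \<inter> C) \<le> \<rho>2 \<longrightarrow>
     (\<exists>A B. A \<subseteq> P - X \<and> B \<subseteq> C - X \<and> sparse_pair n L A B))"

text \<open>The pairs are chosen one by one, applying \<open>linked\<close> to the set of all
  vertices used so far. A piece contains only its own at most \<open>2 ^ card X\<close> sides,
  whereas the centre contains those of all pieces; hence the two bounds in
  \<open>\<rho>\<close>.\<close>

lemma choose_links:
  assumes "finite J" "finite X" "L > 0" and finI: "finite I"
    and JI: "J \<subseteq> I \<times> Pow X"
    and P: "\<And>b. b \<in> I \<Longrightarrow> P b \<subseteq> V - C"
    and disP: "\<And>b b'. b \<in> I \<Longrightarrow> b' \<in> I \<Longrightarrow> b \<noteq> b' \<Longrightarrow> P b \<inter> P b' = {}"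
    and link: "\<And>b. b \<in> I \<Longrightarrow> linked n L \<rho>1 \<rho>2 (P b) C"
    and \<rho>: "2 ^ card X * L \<le> \<rho>1" "card I * 2 ^ card X * L \<le> \<rho>2"
  shows "\<exists>A B. (\<forall>j\<in>J. A j \<subseteq> P (fst j) \<and> B j \<subseteq> C \<and> sparse_pair n L (A j) (B j)) \<and>
    (\<forall>i\<in>J. \<forall>j\<in>J. i \<noteq> j \<longrightarrow> A i \<inter> A j = {} \<and> B i \<inter> B j = {})"
  using assms(1) JI
proof (induction J rule: finite_induct)
  case empty
  then show ?case by auto
next
  case (insert j J)
  then have "J \<subseteq> I \<times> Pow X" by blast
  from insert.IH[OF this] obtain A B
    where AB0: "\<forall>i\<in>J. A i \<subseteq> P (fst i) \<and> B i \<subseteq> C \<and> sparse_pair n L (A i) (B i)"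
    and dis0: "\<forall>i\<in>J. \<forall>i'\<in>J. i \<noteq> i' \<longrightarrow> A i \<inter> A i' = {} \<and> B i \<inter> B i' = {}"
    by (elim exE conjE) (rule that)
  note AB = bspec[OF AB0]
  have dis: "A i \<inter> A i' = {} \<and> B i \<inter> B i' = {}" if "i \<in> J" "i' \<in> J" "i \<noteq> i'" for i i'
    using dis0 that by simp
  have bI: "fst j \<in> I" using insert.prems by auto
  have JI: "fst i \<in> I \<and> snd i \<in> Pow X" if "i \<in> J" for i
  proof -
    have "i \<in> I \<times> Pow X" using insert.prems that by blast
    then show ?thesis by (simp add: mem_Times_iff)
  qed
  have cards: "card (A i) = L" "card (B i) = L" if "i \<in> J" for i
    using AB[OF that] by (auto simp: sparse_pair_def)
  have fins: "finite (A i)" if "i \<in> J" for i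
    using AB[OF that] P JI[OF that] finite_V by (meson finite_Diff finite_subset)
  define Y where "Y = (\<Union>i\<in>J. A i \<union> B i)"
  have "Y \<inter> P (fst j) \<subseteq> (\<Union>i\<in>{i \<in> J. fst i = fst j}. A i)"
  proof
    fix y assume y: "y \<in> Y \<inter> P (fst j)"
    then obtain i where i: "i \<in> J" "y \<in> A i \<union> B i" by (auto simp: Y_def)
    have "y \<notin> B i" using AB[OF i(1)] y P[OF bI] by auto
    then have "y \<in> A i" using i by auto
    then have "fst i = fst j" using AB[OF i(1)] y disP[OF _ bI] JI[OF i(1)] by blast
    then show "y \<in> (\<Union>i\<in>{i \<in> J. fst i = fst j}. A i)" using i(1) \<open>y \<in> A i\<close> by blast
  qed
  then have "card (Y \<inter> P (fst j)) \<le> card (\<Union>i\<in>{i \<in> J. fst i = fst j}. A i)"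
    using insert.hyps(1) fins by (intro card_mono) auto
  also have "\<dots> \<le> (\<Sum>i\<in>{i \<in> J. fst i = fst j}. card (A i))"
    using insert.hyps(1) by (intro card_UN_le) auto
  also have "\<dots> = card {i \<in> J. fst i = fst j} * L" using cards by simp
  also have "card {i \<in> J. fst i = fst j} \<le> card (Pow X)"
  proof (rule card_inj_on_le[where f = snd])
    show "inj_on snd {i \<in> J. fst i = fst j}" by (auto simp: inj_on_def)
  qed (use JI assms(2) in auto)
  also have "card (Pow X) * L \<le> \<rho>1" using \<rho>(1) assms(2) by (simp add: card_Pow)
  finally have 1: "card (Y \<inter> P (fst j)) \<le> \<rho>1" by simp
  have "Y \<inter> C \<subseteq> (\<Union>i\<in>J. B i)" using AB P JI by (fastforce simp: Y_def)
  moreover have finB: "finite (B i)" if "i \<in> J" for i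
    using cards(2)[OF that] \<open>L > 0\<close> card_gt_0_iff[of "B i"] by simp
  ultimately have 2: "card (Y \<inter> C) \<le> \<rho>2"
  proof -
    have "card (Y \<inter> C) \<le> card (\<Union>i\<in>J. B i)"
      using \<open>Y \<inter> C \<subseteq> (\<Union>i\<in>J. B i)\<close> insert.hyps(1) finB by (intro card_mono) auto
    also have "\<dots> \<le> (\<Sum>i\<in>J. card (B i))" using insert.hyps(1) by (intro card_UN_le) auto
    also have "\<dots> = card J * L" using cards by simp
    also have "card J \<le> card (I \<times> Pow X)"
      using insert.prems finI assms(2) by (intro card_mono) auto
    also have "card (I \<times> Pow X) * L \<le> \<rho>2"
      using \<rho>(2) assms(2) by (simp add: card_Pow card_cartesian_product)
    finally show ?thesis by simp
  qed
  obtain A' B' where new: "A' \<subseteq> P (fst j) - Y" "B' \<subseteq> C - Y" "sparse_pair n L A' B'"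
    using link[OF bI, unfolded linked_def, rule_format, OF 1 2] by (elim exE conjE) (rule that)
  have sub: "A i \<subseteq> Y" "B i \<subseteq> Y" if "i \<in> J" for i using that by (auto simp: Y_def)
  have off: "A' \<inter> Y = {}" "B' \<inter> Y = {}" using new(1,2) by auto
  show ?case
  proof (rule exI[of _ "A(j := A')"], rule exI[of _ "B(j := B')"], rule conjI)
    show "\<forall>i\<in>insert j J. (A(j := A')) i \<subseteq> P (fst i) \<and> (B(j := B')) i \<subseteq> C \<and>
      sparse_pair n L ((A(j := A')) i) ((B(j := B')) i)"
      using AB new by auto
    show "\<forall>i\<in>insert j J. \<forall>i'\<in>insert j J. i \<noteq> i' \<longrightarrow>
      (A(j := A')) i \<inter> (A(j := A')) i' = {} \<and> (B(j := B')) i \<inter> (B(j := B')) i' = {}"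
    proof (intro ballI impI)
      fix i i' assume "i \<in> insert j J" "i' \<in> insert j J" "i \<noteq> i'"
      then consider "i \<in> J" "i' \<in> J" "i \<noteq> j" "i' \<noteq> j" | "i = j" "i' \<in> J" "i' \<noteq> j"
        | "i \<in> J" "i' = j" "i \<noteq> j"
        using insert.hyps(2) by blast
      then show "(A(j := A')) i \<inter> (A(j := A')) i' = {} \<and> (B(j := B')) i \<inter> (B(j := B')) i' = {}"
        using dis[of i i'] \<open>i \<noteq> i'\<close> sub[of i] sub[of i'] off by cases auto
    qed
  qed
qed

text \<open>Pieces are indexed by bit patterns, and one sparse pair is reserved for each pattern and
  each window trace; then \<open>embed_star\<close> applies. The reserved \<open>2 ^ s * L\<close>
  vertices of a piece are paid for by \<open>\<rho>1\<close> in \<open>room\<close>.\<close>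

lemma embed_linked:
  fixes n r h s L \<Delta> \<rho>1 \<rho>2 :: nat and P :: "'i \<Rightarrow> 'a set"
  defines "k \<equiv> 2 * h + 1"
  assumes "1 \<le> h" and len: "r * k + s \<le> n"
    and I: "finite I" "2 ^ r \<le> card I"
    and P: "\<And>i. i \<in> I \<Longrightarrow> P i \<subseteq> V - C" and CV: "C \<subseteq> V"
    and disP: "\<And>i i'. i \<in> I \<Longrightarrow> i' \<in> I \<Longrightarrow> i \<noteq> i' \<Longrightarrow> P i \<inter> P i' = {}"
    and indep: "\<And>u v. u \<in> C \<Longrightarrow> v \<in> C \<Longrightarrow> \<not> adj u v"
    and inner: "\<And>i v. i \<in> I \<Longrightarrow> v \<in> P i \<Longrightarrow> card {u \<in> P i. adj v u} \<le> \<Delta>"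
    and link: "\<And>i. i \<in> I \<Longrightarrow> linked n L \<rho>1 \<rho>2 (P i) C"
    and L: "2 * (r * ((k choose h) * 2 ^ (2 * h * (r - 1)) * 2 ^ (n - (r * k + s)))) \<le> L"
      "4 * n * \<Delta> \<le> L" "0 < L" "0 < n"
    and \<rho>: "2 ^ s * L \<le> \<rho>1" "2 ^ (r + s) * L \<le> \<rho>2"
    and room: "\<And>i. i \<in> I \<Longrightarrow> 2 ^ (n - r) + n * \<Delta> + \<rho>1 < card (P i)"
  shows "cube_embeds n"
proof -
  let ?X = "{r * k..<r * k + s}" and ?B = "Pow {..<r}"
  have "card ?B \<le> card I" using I by (simp add: card_Pow)
  then obtain g where g: "g ` ?B \<subseteq> I" "inj_on g ?B"
    using card_le_inj[of ?B I] I by auto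
  have gI: "g b \<in> I" if "b \<in> ?B" for b using g that by blast
  have gne: "g b \<noteq> g b'" if "b \<in> ?B" "b' \<in> ?B" "b \<noteq> b'" for b b'
    using g(2) that by (auto simp: inj_on_def)
  have "\<exists>A B. (\<forall>j\<in>?B \<times> Pow ?X. A j \<subseteq> P (g (fst j)) \<and> B j \<subseteq> C \<and> sparse_pair n L (A j) (B j)) \<and>
    (\<forall>i\<in>?B \<times> Pow ?X. \<forall>j\<in>?B \<times> Pow ?X. i \<noteq> j \<longrightarrow> A i \<inter> A j = {} \<and> B i \<inter> B j = {})"
  proof (rule choose_links[where I = ?B and X = ?X])
    show "P (g b) \<inter> P (g b') = {}" if "b \<in> ?B" "b' \<in> ?B" "b \<noteq> b'" for b b'
      using disP[OF gI gI gne] that by blast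
    show "card ?B * 2 ^ card ?X * L \<le> \<rho>2" using \<rho>(2) by (simp add: card_Pow power_add)
  qed (use P gI link \<rho> L in auto)
  then obtain A B where AB0: "\<forall>j\<in>?B \<times> Pow ?X. A j \<subseteq> P (g (fst j)) \<and> B j \<subseteq> C \<and> sparse_pair n L (A j) (B j)"
    and dis0: "\<forall>i\<in>?B \<times> Pow ?X. \<forall>j\<in>?B \<times> Pow ?X. i \<noteq> j \<longrightarrow> A i \<inter> A j = {} \<and> B i \<inter> B j = {}"
    by (elim exE conjE) (rule that)
  have AB: "\<And>j. j \<in> ?B \<times> Pow ?X \<Longrightarrow> A j \<subseteq> P (g (fst j)) \<and> B j \<subseteq> C \<and> sparse_pair n L (A j) (B j)"
    using AB0 by (rule bspec)
  have dis: "A i \<inter> A j = {} \<and> B i \<inter> B j = {}"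
    if "i \<in> ?B \<times> Pow ?X" "j \<in> ?B \<times> Pow ?X" "i \<noteq> j" for i j
    using bspec[OF bspec[OF dis0 that(1)] that(2)] that(3) by blast
  show ?thesis
  proof (rule embed_star[of h r s n "\<lambda>b. P (g b)" C \<Delta> "\<lambda>b x. A (b, x)" L "\<lambda>b x. B (b, x)"])
    fix b assume "b \<subseteq> {..<r}"
    then have b: "b \<in> ?B" by simp
    show "P (g b) \<subseteq> V - C" by (rule P[OF gI[OF b]])
    show "card {u \<in> P (g b). adj v u} \<le> \<Delta>" if "v \<in> P (g b)" for v
      by (rule inner[OF gI[OF b] that])
    show "2 ^ (n - r) + n * \<Delta> + 2 ^ s * L < card (P (g b))"
      using room[OF gI[OF b]] \<rho>(1) by linarith
    show "P (g b) \<inter> P (g b') = {}" if "b' \<subseteq> {..<r}" "b \<noteq> b'" for b'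
      using disP[OF gI gI gne] b that by simp
    fix x assume "x \<subseteq> {r * (2 * h + 1)..<r * (2 * h + 1) + s}"
    then have bx: "(b, x) \<in> ?B \<times> Pow ?X" using b by (simp add: k_def)
    show "A (b, x) \<subseteq> P (g b) \<and> card (A (b, x)) = L" "B (b, x) \<subseteq> C \<and> card (B (b, x)) = L"
      using AB[OF bx] by (simp_all add: sparse_pair_def)
    show "4 * n * card {u \<in> B (b, x). adj a u} \<le> L" if "a \<in> A (b, x)" for a
      using AB[OF bx] that by (simp add: sparse_pair_def)
    fix x' assume "x' \<subseteq> {r * (2 * h + 1)..<r * (2 * h + 1) + s}"
    then have x': "x' \<in> Pow ?X" by (simp add: k_def)
    show "A (b, x) \<inter> A (b, x') = {}" if "x \<noteq> x'"
      using dis[OF bx, of "(b, x')"] b x' that by auto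
    show "B (b, x) \<inter> B (b', x') = {}" if "b' \<subseteq> {..<r}" "b \<noteq> b' \<or> x \<noteq> x'" for b'
      using dis[OF bx, of "(b', x')"] x' that by auto
  qed (use assms(2) len L CV indep in \<open>auto simp: k_def\<close>)
qed

section \<open>Unlinked sets and the change of centre\<close>

text \<open>Choose \<open>4 * n\<close> disjoint blocks of size \<open>L\<close> in
  \<open>Z0\<close>. A vertex with fewer than \<open>L\<close> neighbours in \<open>Z0\<close> has
  at most \<open>L / (4 * n)\<close> of them in some block. Among \<open>4 * n * L\<close> such
  vertices, \<open>L\<close> share a block and form a sparse pair with it.\<close>

lemma few_small_degrees:
  assumes Y: "Y \<subseteq> V" and Z: "Z0 \<subseteq> Z" "Z \<subseteq> V"
    and none: "\<And>A B. A \<subseteq> Y \<Longrightarrow> B \<subseteq> Z \<Longrightarrow> \<not> sparse_pair n L A B"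
    and "0 < n" "0 < L" and Z0: "4 * n * L \<le> card Z0"
  shows "card {a \<in> Y. card {u \<in> Z0. adj a u} < L} < 4 * n * L"
proof (rule ccontr)
  define A0 where "A0 = {a \<in> Y. card {u \<in> Z0. adj a u} < L}"
  assume "\<not> card {a \<in> Y. card {u \<in> Z0. adj a u} < L} < 4 * n * L"
  then have A0: "4 * n * L \<le> card A0" by (simp add: A0_def)
  have finZ0: "finite Z0" and finY: "finite Y" using Y Z finite_V finite_subset by metis+
  obtain F0 where F0: "finite F0" "pairwise disjnt F0" "\<forall>B\<in>F0. B \<subseteq> Z0 \<and> card B = L"
    "card (Z0 - \<Union>F0) < L"
    using split_into_pieces[OF finZ0 \<open>0 < L\<close>] by auto
  have "4 * n \<le> card F0"
  proof -
    have "card Z0 \<le> card (Z0 - \<Union>F0) + card (\<Union>F0)"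
      by (rule order_trans[OF card_mono card_Un_le])
        (use finZ0 F0 in \<open>auto intro: finite_subset\<close>)
    also have "card (\<Union>F0) \<le> card F0 * L"
      using card_Union_le_sum_card[of F0] F0(3) by simp
    finally have "4 * n * L < (card F0 + 1) * L" using F0(4) Z0 by simp
    then have "4 * n < card F0 + 1" by (simp only: mult_less_cancel2)
    then show ?thesis by simp
  qed
  then obtain F where F: "F \<subseteq> F0" "card F = 4 * n" "finite F"
    by (metis obtain_subset_with_card_n)
  have hit: "\<exists>B\<in>F. 4 * n * card {u \<in> B. adj a u} \<le> L" if "a \<in> A0" for a
  proof (rule ccontr)
    assume "\<not> ?thesis"
    then have big: "L \<le> 4 * n * card {u \<in> B. adj a u}" if "B \<in> F" for B
      using that by (auto simp: not_le intro: less_imp_le)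
    have "4 * n * L = (\<Sum>B\<in>F. L)" using F by simp
    also have "\<dots> \<le> (\<Sum>B\<in>F. 4 * n * card {u \<in> B. adj a u})" using big by (intro sum_mono)
    also have "\<dots> = 4 * n * (\<Sum>B\<in>F. card {u \<in> B. adj a u})" by (simp add: sum_distrib_left)
    also have "(\<Sum>B\<in>F. card {u \<in> B. adj a u}) = card (\<Union>B\<in>F. {u \<in> B. adj a u})"
    proof (rule card_UN_disjoint[symmetric])
      show "\<forall>B\<in>F. finite {u \<in> B. adj a u}"
        using F(1) F0(3) finZ0 by (auto intro: finite_subset)
      show "\<forall>B\<in>F. \<forall>B'\<in>F. B \<noteq> B' \<longrightarrow> {u \<in> B. adj a u} \<inter> {u \<in> B'. adj a u} = {}"
      proof (intro ballI impI)
        fix B B' assume "B \<in> F" "B' \<in> F" "B \<noteq> B'"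
        then have "disjnt B B'" using F(1) F0(2) by (auto dest: pairwiseD)
        then show "{u \<in> B. adj a u} \<inter> {u \<in> B'. adj a u} = {}" by (auto simp: disjnt_def)
      qed
    qed (rule F(3))
    also have "\<dots> \<le> card {u \<in> Z0. adj a u}"
      using F(1) F0(3) finZ0 by (intro card_mono) auto
    finally have "L \<le> card {u \<in> Z0. adj a u}" using \<open>0 < n\<close> by simp
    then show False using that by (simp add: A0_def)
  qed
  define AB where "AB B = {a \<in> A0. 4 * n * card {u \<in> B. adj a u} \<le> L}" for B
  have "\<exists>B\<in>F. L \<le> card (AB B)"
  proof (rule ccontr)
    assume "\<not> ?thesis"
    then have small: "card (AB B) < L" if "B \<in> F" for B using that by auto
    have "card A0 \<le> card (\<Union>B\<in>F. AB B)"
      using hit finY F(3) by (intro card_mono) (auto simp: AB_def A0_def)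
    also have "\<dots> \<le> (\<Sum>B\<in>F. card (AB B))" using F(3) by (rule card_UN_le)
    also have "\<dots> < (\<Sum>B\<in>F. L)"
      using small F \<open>0 < n\<close> by (intro sum_strict_mono) auto
    also have "\<dots> = 4 * n * L" using F by simp
    finally show False using A0 by simp
  qed
  then obtain B A where "B \<in> F" "A \<subseteq> AB B" "card A = L"
    by (metis obtain_subset_with_card_n)
  moreover have "A \<subseteq> Y" using \<open>A \<subseteq> AB B\<close> by (auto simp: AB_def A0_def)
  moreover have "B \<subseteq> Z" "card B = L" using \<open>B \<in> F\<close> F(1) F0(3) Z(1) by blast+
  ultimately show False
    using none[of A B] by (auto simp: sparse_pair_def AB_def)
qed


text \<open>
  Three mutually unlinked sets would span a triangle: \<open>Q\<close> and \<open>P\<close> are not linked to \<open>C\<close>, and \<open>C2\<close> has a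
  large part in some \<open>Y Q\<close>. A vertex \<open>a\<close> of \<open>P\<close> with many neighbours both in \<open>C\<close> and in \<open>C2 \<inter> Y Q\<close> has two
  neighbours that are adjacent to each other.
\<close>

lemma linked_to_second_centre:
  assumes finN: "finite \<N>" and PN: "P \<in> \<N>"
    and Y: "\<And>Q. Q \<in> \<N> \<Longrightarrow> Y Q \<subseteq> V" and C: "C \<subseteq> V" "card C = D"
    and Z: "\<And>Q. Q \<in> \<N> \<Longrightarrow> Z Q \<subseteq> C" "\<And>Q. Q \<in> \<N> \<Longrightarrow> card (C - Z Q) \<le> \<rho>2"
    and none: "\<And>Q A B. Q \<in> \<N> \<Longrightarrow> A \<subseteq> Y Q \<Longrightarrow> B \<subseteq> Z Q \<Longrightarrow> \<not> sparse_pair n L A B"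
    and C2: "C2 \<subseteq> (\<Union>Q\<in>\<N>. Y Q)" "card C2 = D"
    and pos: "0 < n" "0 < L"
    and size: "card \<N> * (4 * n * L) + \<rho>2 \<le> D" "2 * \<rho>2 + 4 * n * L \<le> D"
      "\<rho>1 + 8 * n * L \<le> card (Y P - C2)"
  shows "linked n L \<rho>1 \<rho>2 (Y P - C2) C2"
  unfolding linked_def
proof (intro allI impI, rule ccontr)
  fix X assume X: "card (X \<inter> (Y P - C2)) \<le> \<rho>1" "card (X \<inter> C2) \<le> \<rho>2"
    and "\<not> (\<exists>A B. A \<subseteq> Y P - C2 - X \<and> B \<subseteq> C2 - X \<and> sparse_pair n L A B)"
  then have noneX: "\<And>A B. A \<subseteq> Y P - C2 - X \<Longrightarrow> B \<subseteq> C2 - X \<Longrightarrow> \<not> sparse_pair n L A B"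
    by blast
  have C2V: "C2 \<subseteq> V" using C2(1) Y by blast
  have finC2: "finite C2" and finC: "finite C" and finY: "finite (Y P)"
    using finite_V finite_subset[OF C2V] finite_subset[OF C(1)] finite_subset[OF Y[OF PN]] by simp_all
  have "card (C2 - X) = D - card (X \<inter> C2)"
    using finC2 C2(2) by (simp add: card_Diff_subset_Int Int_commute)
  then have D2: "D - \<rho>2 \<le> card (C2 - X)" using X(2) by simp
  \<comment> \<open>Pigeonhole over the sets \<open>Y Q\<close>, which cover \<open>C2\<close>; the
    case \<open>Q = P\<close> is allowed.\<close>
  have "\<exists>Q\<in>\<N>. 4 * n * L \<le> card ((C2 - X) \<inter> Y Q)"
  proof (rule ccontr)
    assume "\<not> ?thesis"
    then have small: "card ((C2 - X) \<inter> Y Q) < 4 * n * L" if "Q \<in> \<N>" for Q using that by auto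
    have "C2 - X = (\<Union>Q\<in>\<N>. (C2 - X) \<inter> Y Q)" using C2(1) by auto
    then have "card (C2 - X) \<le> (\<Sum>Q\<in>\<N>. card ((C2 - X) \<inter> Y Q))"
      using card_UN_le[OF finN, of "\<lambda>Q. (C2 - X) \<inter> Y Q"] by metis
    also have "\<dots> < (\<Sum>Q\<in>\<N>. 4 * n * L)"
      using small PN finN by (intro sum_strict_mono) auto
    also have "\<dots> = card \<N> * (4 * n * L)" by simp
    finally show False using D2 size(1) by linarith
  qed
  then obtain Q where Q: "Q \<in> \<N>" "4 * n * L \<le> card ((C2 - X) \<inter> Y Q)" by blast
  \<comment> \<open>On this part of \<open>C\<close> the absence of sparse pairs is available for
    \<open>P\<close> and for \<open>Q\<close> at once.\<close>
  define Cs where "Cs = Z P \<inter> Z Q"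
  have "card C \<le> card (Cs \<union> ((C - Z P) \<union> (C - Z Q)))"
    using finC by (intro card_mono) (auto simp: Cs_def intro: finite_subset[OF Z(1)[OF PN]])
  also have "\<dots> \<le> card Cs + (card (C - Z P) + card (C - Z Q))"
    by (meson add_left_mono card_Un_le le_trans)
  finally have Cs: "4 * n * L \<le> card Cs"
    using C(2) Z(2)[OF PN] Z(2)[OF Q(1)] size(2) by linarith
  \<comment> \<open>\<open>E1\<close> and \<open>E2\<close> collect the vertices with too few
    neighbours in \<open>C2\<close> and in \<open>C\<close>, respectively; both are small, and
    \<open>a\<close> is taken outside them.\<close>
  define E1 where "E1 = {a \<in> Y P - C2 - X. card {u \<in> (C2 - X) \<inter> Y Q. adj a u} < L}"
  define E2 where "E2 = {a \<in> Y P. card {u \<in> Cs. adj a u} < L}"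
  have "card E1 < 4 * n * L"
    unfolding E1_def using Y[OF PN] C2V noneX pos Q(2)
    by (intro few_small_degrees[where Z = "C2 - X"]) auto
  moreover have "card E2 < 4 * n * L"
    unfolding E2_def
  proof (rule few_small_degrees[where Z = "Z P"])
    show "Z P \<subseteq> V" using Z(1)[OF PN] C(1) by blast
  qed (use Y[OF PN] none[OF PN] pos Cs in \<open>auto simp: Cs_def\<close>)
  moreover have "card (E1 \<union> E2) \<le> card E1 + card E2" by (rule card_Un_le)
  moreover have "8 * n * L \<le> card (Y P - C2 - X)"
  proof -
    have "card (Y P - C2 - X) = card (Y P - C2) - card (X \<inter> (Y P - C2))"
      using finY by (simp add: card_Diff_subset_Int Int_commute)
    then show ?thesis using X(1) size(3) by linarith
  qed
  ultimately have "card (E1 \<union> E2) < card (Y P - C2 - X)" by linarith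
  moreover have "finite (E1 \<union> E2)" using finY by (simp add: E1_def E2_def)
  ultimately have "\<not> Y P - C2 - X \<subseteq> E1 \<union> E2" by (meson card_mono not_less)
  then obtain a where a: "a \<in> Y P - C2 - X" "a \<notin> E1" "a \<notin> E2" by blast
  have "L \<le> card {u \<in> (C2 - X) \<inter> Y Q. adj a u}" using a by (simp add: E1_def)
  then obtain T where T: "T \<subseteq> {u \<in> (C2 - X) \<inter> Y Q. adj a u}" "card T = L"
    by (metis obtain_subset_with_card_n)
  have "L \<le> card {u \<in> Cs. adj a u}" using a by (simp add: E2_def)
  then obtain B where B: "B \<subseteq> {u \<in> Cs. adj a u}" "card B = L"
    by (metis obtain_subset_with_card_n)
  have "\<not> sparse_pair n L T B"
    using none[OF Q(1), of T B] T(1) B(1) by (auto simp: Cs_def)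
  then obtain t where t: "t \<in> T" "\<not> 4 * n * card {u \<in> B. adj t u} \<le> L"
    using T B by (auto simp: sparse_pair_def)
  have "{u \<in> B. adj t u} \<noteq> {}"
  proof
    assume "{u \<in> B. adj t u} = {}"
    then have "card {u \<in> B. adj t u} = 0" by (simp only: card.empty)
    then show False using t(2) by simp
  qed
  then obtain c where c: "c \<in> B" "adj t c" by blast
  have "adj a t" "adj a c" using T(1) t(1) B(1) c(1) by blast+
  then show False using no_triangle[of a t c] c(2) by blast
qed

section \<open>The case analysis\<close>

text \<open>\<open>D\<close> is both the degree threshold and the size of a centre. If some degree
  reaches \<open>D\<close> but fewer than \<open>2 ^ r\<close> pieces are linked to the centre, at
  least \<open>q\<close> unlinked pieces remain, and the same dichotomy is applied to their union. A
  piece may lose \<open>\<rho>1\<close> vertices three times: to the set witnessing that it is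
  unlinked, to the second centre, and to the sparse pairs.\<close>

lemma embed_cube:
  fixes n r h s L K M D q \<tau> \<Delta> \<rho>1 \<rho>2 :: nat
  defines "k \<equiv> 2 * h + 1"
  assumes pos: "1 \<le> h" "0 < n" "0 < L" "0 < K" "0 < M"
    and len: "r * k + s \<le> n"
    and L: "2 * (r * ((k choose h) * 2 ^ (2 * h * (r - 1)) * 2 ^ (n - (r * k + s)))) \<le> L"
      "4 * n * \<Delta> \<le> L"
    and \<Delta>: "K \<le> M * \<Delta>"
    and \<rho>: "2 ^ s * L \<le> \<rho>1" "2 ^ (r + s) * L \<le> \<rho>2"
    and room: "2 ^ (n - r) + n * \<Delta> + 3 * \<rho>1 < K" "8 * n * L + 3 * \<rho>1 \<le> K"
      "2 ^ (n - r) + n * \<Delta> + 2 * r * \<tau> + \<rho>1 < K"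
    and many: "2 ^ r + r * (K * D div (\<tau> + 1)\<^sup>2) \<le> q" "2 ^ r + D div (\<rho>1 + 1) \<le> q"
    and size: "(2 ^ r + q + M) * K + D \<le> card V" "card V * (4 * n * L) + \<rho>2 * K \<le> D * K"
      "2 * \<rho>2 + 4 * n * L \<le> D"
  shows "cube_embeds n"
proof -
  have rn: "r \<le> n"
  proof -
    have "r \<le> r * k" by (simp add: k_def)
    then show ?thesis using len by linarith
  qed
  have small_inner: "card {u \<in> P. adj v u} \<le> \<Delta>"
    if "M * card {u \<in> P. adj v u} \<le> K" for P v
  proof -
    have "M * card {u \<in> P. adj v u} \<le> M * \<Delta>" using that \<Delta> by (rule order_trans)
    then show ?thesis using pos by simp
  qed
  show ?thesis
  proof (cases "\<exists>v. D \<le> card {u \<in> V. adj v u}")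
    case False
    then have deg: "card {u \<in> V. adj v u} \<le> D" for v by (meson nat_le_linear)
    obtain F where F: "finite F" "pairwise disjnt F"
      "\<forall>P\<in>F. P \<subseteq> V \<and> card P = K \<and> (\<forall>v\<in>P. M * card {u \<in> P. adj v u} \<le> K)"
      "card (V - \<Union>F) \<le> M * K"
      using pieces_exist[OF order_refl pos(4,5)] by blast
    have UF: "\<Union>F \<subseteq> V" using F(3) by blast
    have "card V \<le> card (V - \<Union>F) + card (\<Union>F)"
      by (rule order_trans[OF card_mono card_Un_le]) (use finite_V finite_subset[OF UF] in auto)
    also have "card (\<Union>F) \<le> card F * K"
      using card_Union_le_sum_card[of F] F(3) by simp
    finally have "(2 ^ r + q + M) * K \<le> (M + card F) * K"
      using F(4) size(1) by (simp add: algebra_simps)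
    then have "q \<le> card F" using pos by simp
    show ?thesis
    proof (rule embed_low_degree[where F = F and r = r and K = K and ?K1.0 = K and D = D and \<tau> = \<tau> and \<Delta> = \<Delta>])
      show "card {u \<in> \<Union>F. adj v u} \<le> D" for v
      proof (rule order_trans[OF card_mono deg[of v]])
        show "{u \<in> \<Union>F. adj v u} \<subseteq> {u \<in> V. adj v u}" using UF by blast
      qed (use finite_V in simp)
      show "2 ^ r + r * (K * D div (\<tau> + 1)\<^sup>2) \<le> card F" using many(1) \<open>q \<le> card F\<close> by linarith
      show "2 ^ (n - r) + n * \<Delta> + 2 * r * \<tau> < K" using room(3) by linarith
      show "card {u \<in> P. adj v u} \<le> \<Delta>" if "P \<in> F" "v \<in> P" for P v
        using F(3) that by (intro small_inner) blast
    qed (use F rn in auto)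
  next
    case True
    then obtain v0 C where C: "C \<subseteq> {u \<in> V. adj v0 u}" "card C = D"
      by (metis obtain_subset_with_card_n)
    have CV: "C \<subseteq> V" using C(1) by blast
    have finC: "finite C" using CV finite_V by (rule finite_subset)
    have indepC: "\<not> adj u v" if "u \<in> C" "v \<in> C" for u v
      using C(1) that no_triangle by blast
    obtain F where F: "finite F" "pairwise disjnt F"
      "\<forall>P\<in>F. P \<subseteq> V - C \<and> card P = K \<and> (\<forall>v\<in>P. M * card {u \<in> P. adj v u} \<le> K)"
      "card (V - C - \<Union>F) \<le> M * K"
      using pieces_exist[of "V - C" K M] pos(4,5) by (metis Diff_subset)
    have UF: "\<Union>F \<subseteq> V - C" using F(3) by blast
    have finP: "finite P" if "P \<in> F" for P
    proof -
      have "P \<subseteq> V" using UF that by blast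
      then show ?thesis using finite_V by (rule finite_subset)
    qed
    have "card (\<Union>F) = card F * K"
      using card_Union_disjoint[OF F(2)] finP F(3) by simp
    moreover have "card (\<Union>F) \<le> card V" using UF finite_V by (intro card_mono) auto
    ultimately have FV: "card F * K \<le> card V" by simp
    have "card V \<le> card C + card (V - C)"
      using card_Un_le[of C "V - C"] CV by (simp add: Un_absorb1)
    also have "card (V - C) \<le> card (V - C - \<Union>F) + card (\<Union>F)"
      by (rule order_trans[OF card_mono card_Un_le]) (use finite_V finite_subset[OF UF] in auto)
    finally have "(2 ^ r + q + M) * K \<le> (M + card F) * K"
      using F(4) size(1) C(2) \<open>card (\<Union>F) = card F * K\<close> by (simp add: algebra_simps)
    then have qF: "2 ^ r + q \<le> card F" using pos by simp
    show ?thesis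
    proof (cases "2 ^ r \<le> card {P \<in> F. linked n L \<rho>1 \<rho>2 P C}")
      case True
      show ?thesis
      proof (rule embed_linked[of h r s n "{P \<in> F. linked n L \<rho>1 \<rho>2 P C}" "\<lambda>P. P" C \<Delta> L \<rho>1 \<rho>2])
        show "P \<inter> P' = {}" if "P \<in> {P \<in> F. linked n L \<rho>1 \<rho>2 P C}"
          "P' \<in> {P \<in> F. linked n L \<rho>1 \<rho>2 P C}" "P \<noteq> P'" for P P'
          using that F(2) by (auto simp: pairwise_def disjnt_def)
        show "card {u \<in> P. adj v u} \<le> \<Delta>" if "P \<in> {P \<in> F. linked n L \<rho>1 \<rho>2 P C}" "v \<in> P" for P v
          using F(3) that by (intro small_inner) blast
      qed (use True F pos len L \<rho> room CV indepC in \<open>auto simp: k_def\<close>)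
    next
      case False
      define \<N> where "\<N> = {P \<in> F. \<not> linked n L \<rho>1 \<rho>2 P C}"
      have NF: "\<N> \<subseteq> F" and finN: "finite \<N>" using F(1) by (auto simp: \<N>_def)
      have "F = \<N> \<union> {P \<in> F. linked n L \<rho>1 \<rho>2 P C}" by (auto simp: \<N>_def)
      then have "card F \<le> card \<N> + card {P \<in> F. linked n L \<rho>1 \<rho>2 P C}" by (metis card_Un_le)
      then have qN: "q \<le> card \<N>" using False qF by linarith
      \<comment> \<open>\<open>X P\<close> witnesses that \<open>P\<close> is unlinked; deleting it
        leaves no sparse pair between \<open>P\<close> and \<open>C\<close>.\<close>
      have "\<exists>X. \<forall>P\<in>\<N>. card (X P \<inter> P) \<le> \<rho>1 \<and> card (X P \<inter> C) \<le> \<rho>2 \<and>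
        (\<forall>A B. A \<subseteq> P - X P \<longrightarrow> B \<subseteq> C - X P \<longrightarrow> \<not> sparse_pair n L A B)"
        by (rule bchoice) (auto simp: \<N>_def linked_def)
      then obtain X where X0: "\<forall>P\<in>\<N>. card (X P \<inter> P) \<le> \<rho>1 \<and> card (X P \<inter> C) \<le> \<rho>2 \<and>
        (\<forall>A B. A \<subseteq> P - X P \<longrightarrow> B \<subseteq> C - X P \<longrightarrow> \<not> sparse_pair n L A B)"
        by (elim exE) (rule that)
      have X: "card (X P \<inter> P) \<le> \<rho>1" "card (X P \<inter> C) \<le> \<rho>2" if "P \<in> \<N>" for P
        using X0 that by blast+
      have noneX: "\<not> sparse_pair n L A B" if "P \<in> \<N>" "A \<subseteq> P - X P" "B \<subseteq> C - X P" for P A B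
        using bspec[OF X0 that(1)] that(2,3) by blast
      define Y where "Y P = P - X P" for P
      have YP: "Y P \<subseteq> P" for P by (auto simp: Y_def)
      have cardY: "K \<le> card (Y P) + \<rho>1" if "P \<in> \<N>" for P
      proof -
        have "card (Y P) = card P - card (X P \<inter> P)"
          using finP NF that by (simp add: Y_def card_Diff_subset_Int Int_commute subset_iff)
        then show ?thesis using X(1)[OF that] F(3) NF that by auto
      qed
      have PF: "P \<subseteq> V - C" "card P = K" if "P \<in> \<N>" for P using F(3) NF that by auto
      have innerY: "card {u \<in> Y P. adj v u} \<le> \<Delta>" if "P \<in> \<N>" "v \<in> Y P" for P v
      proof (rule small_inner)
        have "card {u \<in> Y P. adj v u} \<le> card {u \<in> P. adj v u}"
          using YP finP NF that by (intro card_mono) auto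
        then have "M * card {u \<in> Y P. adj v u} \<le> M * card {u \<in> P. adj v u}" by simp
        also have "\<dots> \<le> K" using bspec[OF F(3), of P] NF that(1) subsetD[OF YP that(2)] by blast
        finally show "M * card {u \<in> Y P. adj v u} \<le> K" .
      qed
      have disY: "Y P \<inter> Y P' = {}" if "P \<in> \<N>" "P' \<in> \<N>" "P \<noteq> P'" for P P'
      proof -
        have "disjnt P P'" using F(2) NF that by (auto dest: pairwiseD)
        then show ?thesis using YP[of P] YP[of P'] by (auto simp: disjnt_def)
      qed
      have \<rho>K: "\<rho>1 < K" using room(1) by linarith
      have Yne: "Y P \<noteq> {}" if "P \<in> \<N>" for P using cardY[OF that] \<rho>K by auto
      have injY: "inj_on Y \<N>" using disY Yne unfolding inj_on_def by (metis Int_absorb)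
      define W where "W = (\<Union>P\<in>\<N>. Y P)"
      have WV: "W \<subseteq> V" using YP PF(1) by (auto simp: W_def)
      show ?thesis
      proof (cases "\<exists>v. D \<le> card {u \<in> W. adj v u}")
        case False
        show ?thesis
        proof (rule embed_low_degree[where F = "Y ` \<N>" and r = r and K = K and ?K1.0 = "K - \<rho>1" and D = D and \<tau> = \<tau> and \<Delta> = \<Delta>])
          show "finite (Y ` \<N>)" using finN by simp
          show "pairwise disjnt (Y ` \<N>)" using disY by (auto simp: pairwise_def disjnt_def)
          show "card {u \<in> \<Union>(Y ` \<N>). adj v u} \<le> D" for v
            using False by (metis W_def nat_le_linear)
          show "2 ^ r + r * (K * D div (\<tau> + 1)\<^sup>2) \<le> card (Y ` \<N>)"
            using many(1) qN by (simp add: card_image[OF injY])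
          show "2 ^ (n - r) + n * \<Delta> + 2 * r * \<tau> < K - \<rho>1" using room(3) by linarith
          show "P \<subseteq> V \<and> K - \<rho>1 \<le> card P \<and> card P \<le> K" if PY: "P \<in> Y ` \<N>" for P
          proof -
            obtain P0 where P0: "P0 \<in> \<N>" "P = Y P0" using PY by blast
            have "card P \<le> card P0" using P0 YP finP NF by (auto intro!: card_mono)
            then show ?thesis using P0 PF[OF P0(1)] YP cardY[OF P0(1)] by auto
          qed
          show "card {u \<in> P. adj v u} \<le> \<Delta>" if "P \<in> Y ` \<N>" "v \<in> P" for P v
            using that innerY by auto
        qed (rule rn)
      next
        case True
        then obtain v2 C2 where C2: "C2 \<subseteq> {u \<in> W. adj v2 u}" "card C2 = D"
          by (metis obtain_subset_with_card_n)
        have C2W: "C2 \<subseteq> W" using C2(1) by blast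
        have finC2: "finite C2" using finite_subset[OF C2W finite_subset[OF WV finite_V]] .
        have indepC2: "\<not> adj u v" if "u \<in> C2" "v \<in> C2" for u v
          using C2(1) that no_triangle by blast
        \<comment> \<open>Pieces with more than \<open>\<rho>1\<close> vertices in \<open>C2\<close>
          would lose too much. Being disjoint, there are at most \<open>D div (\<rho>1 + 1)\<close>
          of them.\<close>
        define I where "I = {P \<in> \<N>. card (Y P \<inter> C2) \<le> \<rho>1}"
        have IN: "I \<subseteq> \<N>" and finI: "finite I" using finN by (auto simp: I_def)
        have "card (\<N> - I) * (\<rho>1 + 1) = (\<Sum>P\<in>\<N> - I. \<rho>1 + 1)" by simp
        also have "\<dots> \<le> (\<Sum>P\<in>\<N> - I. card (Y P \<inter> C2))"
          by (intro sum_mono) (auto simp: I_def)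
        also have "\<dots> = card (\<Union>P\<in>\<N> - I. Y P \<inter> C2)"
          using finN finC2 disY by (intro card_UN_disjoint[symmetric]) auto
        also have "\<dots> \<le> D" using C2(2) finC2 by (metis (no_types, lifting) UN_least card_mono inf_le2)
        finally have "card (\<N> - I) \<le> D div (\<rho>1 + 1)" by (simp add: less_eq_div_iff_mult_less_eq)
        moreover have "card \<N> = card I + card (\<N> - I)"
          using IN finN by (metis card_Diff_subset card_mono finI le_add_diff_inverse)
        ultimately have cardI: "2 ^ r \<le> card I" using many(2) qN by linarith
        have cardY2: "K \<le> card (Y P - C2) + 2 * \<rho>1" if "P \<in> I" for P
        proof -
          have "finite (Y P)" using finite_subset[OF YP finP] NF IN that by blast
          then have "card (Y P - C2) = card (Y P) - card (Y P \<inter> C2)"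
            by (simp add: card_Diff_subset_Int)
          then show ?thesis using cardY[of P] that by (auto simp: I_def)
        qed
        show ?thesis
        proof (rule embed_linked[of h r s n I "\<lambda>P. Y P - C2" C2 \<Delta> L \<rho>1 \<rho>2])
          show "Y P - C2 \<subseteq> V - C2" if "P \<in> I" for P using that IN YP PF(1) by blast
          show "(Y P - C2) \<inter> (Y P' - C2) = {}" if "P \<in> I" "P' \<in> I" "P \<noteq> P'" for P P'
            using disY[of P P'] that IN by blast
          show "card {u \<in> Y P - C2. adj v u} \<le> \<Delta>" if "P \<in> I" "v \<in> Y P - C2" for P v
          proof -
            have "finite (Y P)" using finite_subset[OF YP finP] NF IN that by blast
            then have "card {u \<in> Y P - C2. adj v u} \<le> card {u \<in> Y P. adj v u}"
              by (intro card_mono) auto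
            also have "\<dots> \<le> \<Delta>" using that IN by (intro innerY) auto
            finally show ?thesis .
          qed
          show "2 ^ (n - r) + n * \<Delta> + \<rho>1 < card (Y P - C2)" if "P \<in> I" for P
            using cardY2[OF that] room(1) by linarith
          show "linked n L \<rho>1 \<rho>2 (Y P - C2) C2" if "P \<in> I" for P
          proof (rule linked_to_second_centre[of \<N> P Y C D "\<lambda>Q. C - X Q" \<rho>2 n L C2 \<rho>1])
            show "P \<in> \<N>" using that IN by blast
            show "C - X Q \<subseteq> C" for Q by blast
            show "card (C - (C - X Q)) \<le> \<rho>2" if "Q \<in> \<N>" for Q
              using X(2)[OF that] by (simp add: double_diff Diff_Diff_Int Int_commute)
            show "\<not> sparse_pair n L A B" if "Q \<in> \<N>" "A \<subseteq> Y Q" "B \<subseteq> C - X Q" for Q A B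
              using noneX[of Q A B] that by (simp add: Y_def)
            show "\<rho>1 + 8 * n * L \<le> card (Y P - C2)" using cardY2[OF that] room(2) by linarith
            show "card \<N> * (4 * n * L) + \<rho>2 \<le> D"
            proof -
              have "card \<N> \<le> card F" using NF F(1) by (rule card_mono[rotated])
              then have "card \<N> * K \<le> card V" using FV by (meson le_trans mult_le_mono1)
              then have "card \<N> * K * (4 * n * L) \<le> card V * (4 * n * L)" by (rule mult_le_mono1)
              moreover have "(card \<N> * (4 * n * L) + \<rho>2) * K = card \<N> * K * (4 * n * L) + \<rho>2 * K"
                by (simp add: algebra_simps)
              ultimately have "(card \<N> * (4 * n * L) + \<rho>2) * K \<le> D * K"
                using size(2) by linarith
              then show ?thesis using pos by simp
            qed
          qed (use finN YP PF CV C C2 C2W pos size in \<open>auto simp: W_def\<close>)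
        qed (use finI cardI C2W WV indepC2 pos len L \<rho> in \<open>auto simp: k_def\<close>)
      qed
    qed
  qed
qed

end

section \<open>Choice of the parameters\<close>

text \<open>Consecutive central coefficients \<open>c\<close>, \<open>d\<close> satisfy
  \<open>(h + 1) * d = 2 * (2 * h + 1) * c\<close>, and
  \<open>(2 * h + 1) * (2 * h + 3) \<le> 4 * (h + 1)\<^sup>2\<close>.\<close>

lemma central_binomial_square_le: "(2 * h choose h)\<^sup>2 * (2 * h + 1) \<le> 16 ^ h"
proof (induction h)
  case (Suc h)
  let ?c = "2 * h choose h" and ?d = "2 * Suc h choose Suc h" and ?m = "Suc (2 * h) choose h"
  have "Suc h * ?d = Suc h * (2 * ?m)" using Suc_times_binomial[of h "Suc (2 * h)"] by simp
  then have d: "?d = 2 * ?m" by (simp only: mult_left_cancel)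
  have "Suc (2 * h) choose Suc h = ?m" using binomial_symmetric[of h "Suc (2 * h)"] by simp
  then have m: "Suc h * ?m = (2 * h + 1) * ?c" using Suc_times_binomial[of h "2 * h"] by simp
  have "(Suc h)\<^sup>2 * (?d\<^sup>2 * (2 * Suc h + 1)) = 4 * (Suc h * ?m)\<^sup>2 * (2 * h + 3)"
    by (simp only: d) (simp add: power2_eq_square algebra_simps)
  also have "\<dots> = (4 * (2 * h + 1) * (2 * h + 3)) * (?c\<^sup>2 * (2 * h + 1))"
    by (simp only: m) (simp add: power2_eq_square algebra_simps)
  also have "\<dots> \<le> (16 * (Suc h)\<^sup>2) * 16 ^ h"
    by (rule mult_le_mono[OF _ Suc.IH]) (simp add: power2_eq_square algebra_simps)
  finally have "(Suc h)\<^sup>2 * (?d\<^sup>2 * (2 * Suc h + 1)) \<le> (Suc h)\<^sup>2 * 16 ^ Suc h" by simp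
  then show ?case by (simp only: mult_le_cancel1) simp
qed simp

text \<open>A root-free form of the bound of order \<open>2 ^ k / sqrt k\<close> for
  \<open>k = 2 * h + 1\<close>; it makes the shell thin. Pascal's rule reduces it to the central
  coefficient of the even row.\<close>

lemma middle_binomial_le:
  fixes c :: nat
  assumes "4 * c\<^sup>2 \<le> 2 * h + 1"
  shows "c * ((2 * h + 1) choose h) \<le> 2 ^ (2 * h)"
proof -
  let ?m = "(2 * h + 1) choose h"
  have "?m \<le> 2 * (2 * h choose h)"
  proof (cases h)
    case (Suc h')
    then have "?m = (2 * h choose h') + (2 * h choose h)" by simp
    also have "2 * h choose h' \<le> 2 * h choose h" by (rule binomial_maximum')
    finally show ?thesis by simp
  qed simp
  then have "?m\<^sup>2 \<le> (2 * (2 * h choose h))\<^sup>2" by (rule power_mono) simp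
  then have "?m\<^sup>2 * (2 * h + 1) \<le> (2 * (2 * h choose h))\<^sup>2 * (2 * h + 1)" by (rule mult_le_mono1)
  also have "\<dots> = 4 * ((2 * h choose h)\<^sup>2 * (2 * h + 1))" by (simp add: power_mult_distrib)
  also have "\<dots> \<le> 4 * 16 ^ h" by (intro mult_le_mono2 central_binomial_square_le)
  finally have "c\<^sup>2 * (?m\<^sup>2 * (2 * h + 1)) \<le> c\<^sup>2 * (4 * 16 ^ h)" by (rule mult_le_mono2)
  also have "\<dots> = 4 * c\<^sup>2 * 16 ^ h" by simp
  also have "\<dots> \<le> (2 * h + 1) * 16 ^ h" using assms by (rule mult_le_mono1)
  finally have "(2 * h + 1) * (c * ?m)\<^sup>2 \<le> (2 * h + 1) * 16 ^ h"
    by (simp only: power_mult_distrib mult.assoc mult.commute mult.left_commute)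
  then have "(c * ?m)\<^sup>2 \<le> 16 ^ h" by (simp only: mult_le_cancel1)
  also have "(16 :: nat) ^ h = (2 ^ (2 * h))\<^sup>2" by (simp add: power_mult power2_eq_square flip: power_mult_distrib)
  finally show ?thesis by (rule power2_le_imp_le) simp
qed

text \<open>Equality holds at 16; afterwards
  \<open>(t + 1) ^ 4 \<le> t ^ 4 + 16 * t ^ 3 \<le> 2 * t ^ 4\<close>.\<close>

lemma pow4_le_two_pow: "16 \<le> t \<Longrightarrow> t ^ 4 \<le> (2 :: nat) ^ t"
proof (induction t rule: nat_induct_at_least)
  case (Suc t)
  have "Suc t ^ 4 = t ^ 4 + 4 * t ^ 3 + 6 * t ^ 2 + 4 * t + 1"
    by (simp add: eval_nat_numeral algebra_simps)
  also have "\<dots> \<le> t ^ 4 + 16 * t ^ 3"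
  proof -
    have "6 * t ^ 2 + 4 * t + 1 \<le> 12 * t ^ 3"
    proof -
      have "1 \<le> t" using Suc by simp
      then have "1 \<le> t ^ 3" "t \<le> t ^ 3" "t ^ 2 \<le> t ^ 3"
        by (simp_all add: power_increasing self_le_power)
      then show ?thesis by linarith
    qed
    then show ?thesis by linarith
  qed
  also have "16 * t ^ 3 \<le> t * t ^ 3" using Suc by (intro mult_le_mono1) simp
  also have "t * t ^ 3 = t ^ 4" by (simp add: eval_nat_numeral)
  finally show ?case using Suc by simp
qed simp

context triangle_free
begin

text \<open>
  Here \<open>U\<close> is roughly the fourth root of \<open>n\<close>, the surplus in \<open>card V\<close> is \<open>2 ^ n / E\<close>, and all sizes are
  monomials in \<open>U\<close>, \<open>W\<close> and the inner degree \<open>\<Delta>\<close> of the pieces; in particular \<open>2 ^ n = f * U ^ 13\<close>.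
\<close>

lemma embed_cube_powers:
  fixes U W E f \<Delta> n r s h :: nat
  assumes U: "U = 512 * E * W" and pos: "1 \<le> W" "1 \<le> E" "0 < \<Delta>" "0 < n" "1 \<le> h"
    and n: "n \<le> U ^ 4" and r: "2 ^ r = U ^ 12" and s: "2 ^ s = 8 * U ^ 4"
    and f: "f = 32 * W * \<Delta> * U ^ 10" and T: "2 ^ (n - r) = f * U"
    and W: "2 ^ 16 * E\<^sup>2 * r ^ 3 \<le> W" and rpos: "1 \<le> r"
    and bin: "r * U * ((2 * h + 1) choose h) \<le> 2 ^ (2 * h)"
    and len: "r * (2 * h + 1) + s \<le> n"
    and V: "card V = 2 * (f * U ^ 13) + 512 * W * f * U ^ 12"
  shows "cube_embeds n"
proof -
  \<comment> \<open>Chosen so that \<open>2 ^ s * L = 2 * f\<close> and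
    \<open>4 * n * L \<le> f\<close>.\<close>
  define L where "L = 8 * W * \<Delta> * U ^ 6"
  have Upos: "1 \<le> U" "512 * W \<le> U" using U pos by auto
  have fpos: "1 \<le> f" using f pos Upos by simp
  have p11: "U ^ 11 = U * U ^ 10" and p12: "U ^ 12 = U * U ^ 11" and p13: "U ^ 13 = U * U ^ 12"
    by (simp_all flip: power_Suc)
  have UW: "U \<le> 4 * W\<^sup>2"
  proof -
    have "E * 1 \<le> E\<^sup>2 * r ^ 3"
      using pos rpos by (intro mult_le_mono) (auto simp: power2_eq_square)
    then have "512 * E \<le> 2 ^ 16 * E\<^sup>2 * r ^ 3" by simp
    also have "\<dots> \<le> 4 * W" using W by simp
    finally have "512 * E * W \<le> 4 * W * W" by (rule mult_le_mono1)
    then show ?thesis using U by (simp add: power2_eq_square)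
  qed
  have fL: "f = 4 * U ^ 4 * L"
    by (simp add: f L_def)
  have nL: "4 * n * L \<le> f" using n by (simp add: fL)
  have n\<Delta>: "n * \<Delta> \<le> f"
  proof -
    have "n * \<Delta> \<le> U ^ 4 * \<Delta>" using n by simp
    also have "\<dots> \<le> U ^ 10 * \<Delta>" using Upos by (intro mult_le_mono1 power_increasing) auto
    also have "\<dots> \<le> 32 * W * (U ^ 10 * \<Delta>)" using pos by simp
    finally show ?thesis by (simp add: f algebra_simps)
  qed
  have rn: "r \<le> n" using len by (simp add: algebra_simps)
  \<comment> \<open>\<open>K\<close> exceeds \<open>2 ^ (n - r) = f * U\<close> by
    \<open>32 * (W * f)\<close>, which pays for \<open>3 * \<rho>1\<close>, for the inner degrees
    and for the discarded bad vertices.\<close>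
  define \<rho>1 where "\<rho>1 = 2 * (W * f)"
  define K where "K = f * U + 32 * (W * f)"
  have fW: "f \<le> W * f" using pos by simp
  have WfU: "512 * (W * f) \<le> f * U" using mult_le_mono2[OF Upos(2), of f] by (simp add: mult.assoc mult.commute mult.left_commute)
  \<comment> \<open>With this threshold \<open>r\<close> cells together cost at most
    \<open>\<rho>1\<close>, while \<open>\<tau> + 1\<close> is still at least
    \<open>\<rho>1 / r\<close>.\<close>
  define \<tau> where "\<tau> = \<rho>1 div r"
  have r\<tau>: "r * \<tau> \<le> \<rho>1" "\<rho>1 \<le> r * (\<tau> + 1)"
    using rpos by (simp_all add: \<tau>_def dividend_less_times_div less_imp_le)
  define D where "D = 16 * (f * U ^ 12)"
  have f12: "f \<le> f * U ^ 12" "f * U * U ^ 12 = f * U ^ 13"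
    using Upos by (simp_all add: p13)
  show ?thesis
  proof (rule embed_cube[where n = n and r = r and h = h and s = s and L = L and K = K and M = "64 * W * U ^ 11"
        and D = D and q = "U ^ 12 + 32 * W * U ^ 11"
        and \<tau> = \<tau> and \<Delta> = \<Delta> and ?\<rho>1.0 = \<rho>1 and ?\<rho>2.0 = "2 * (f * U ^ 12)"])
    show "1 \<le> h" "0 < n" "r * (2 * h + 1) + s \<le> n" by fact+
    show "0 < L" "0 < K" "0 < 64 * W * U ^ 11"
      using pos Upos fpos by (simp_all add: L_def K_def)
    show "2 * (r * (((2 * h + 1) choose h) * 2 ^ (2 * h * (r - 1)) * 2 ^ (n - (r * (2 * h + 1) + s)))) \<le> L"
      (is "?lhs \<le> L")
    proof -
      \<comment> \<open>The claim is multiplied by \<open>U\<close>, to apply \<open>bin\<close>,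
        and by \<open>2 ^ s\<close>, to cancel the window; both sides are then compared with
        \<open>2 * 2 ^ (n - r)\<close>.\<close>
      have "?lhs * U = 2 * ((r * U * ((2 * h + 1) choose h)) * 2 ^ (2 * h * (r - 1)) * 2 ^ (n - (r * (2 * h + 1) + s)))"
        by (simp only: mult.assoc mult.commute mult.left_commute)
      also have "\<dots> \<le> 2 * (2 ^ (2 * h) * 2 ^ (2 * h * (r - 1)) * 2 ^ (n - (r * (2 * h + 1) + s)))"
        using bin by (intro mult_le_mono2 mult_le_mono1)
      also have "\<dots> = 2 * 2 ^ (2 * h + 2 * h * (r - 1) + (n - (r * (2 * h + 1) + s)))"
        by (simp only: power_add)
      also have "2 * h + 2 * h * (r - 1) + (n - (r * (2 * h + 1) + s)) = n - r - s"
      proof -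
        have "2 * h + 2 * h * (r - 1) = 2 * h * r" using rpos by (cases r) auto
        then show ?thesis using len by (simp add: algebra_simps)
      qed
      finally have "?lhs * U * 2 ^ s \<le> 2 * 2 ^ (n - r - s) * 2 ^ s" by (rule mult_le_mono1)
      also have "2 * 2 ^ (n - r - s) * 2 ^ s = 2 * (2 :: nat) ^ (n - r)"
      proof -
        have "s \<le> n - r" using len by (simp add: algebra_simps)
        then show ?thesis by (simp add: power_add[symmetric])
      qed
      also have "\<dots> = L * U * 2 ^ s" unfolding T s fL by simp
      finally have "?lhs * (U * 2 ^ s) \<le> L * (U * 2 ^ s)" by (simp only: mult.assoc)
      then show ?thesis using Upos by (simp only: mult_le_cancel2) simp
    qed
    show "4 * n * \<Delta> \<le> L"
    proof -
      have "n \<le> U ^ 6" using n Upos power_increasing[of 4 6 U] by simp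
      then have "4 * n * \<Delta> \<le> 4 * U ^ 6 * \<Delta>" by simp
      also have "\<dots> \<le> 8 * W * \<Delta> * U ^ 6" using pos by simp
      finally show ?thesis by (simp add: L_def)
    qed
    show "K \<le> 64 * W * U ^ 11 * \<Delta>"
    proof -
      have "64 * W * U ^ 11 * \<Delta> = 2 * (f * U)" by (simp add: f p11)
      moreover have "32 * (W * f) \<le> f * U" using WfU by linarith
      ultimately show ?thesis unfolding K_def by linarith
    qed
    show "2 ^ s * L \<le> \<rho>1"
    proof -
      have "2 ^ s * L = 2 * f" by (simp add: s fL)
      then show ?thesis using fW unfolding \<rho>1_def by linarith
    qed
    show "2 ^ (r + s) * L \<le> 2 * (f * U ^ 12)" by (simp add: power_add r s fL)
    show "2 ^ (n - r) + n * \<Delta> + 3 * \<rho>1 < K"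
      using n\<Delta> fW fpos unfolding T \<rho>1_def K_def by linarith
    show "8 * n * L + 3 * \<rho>1 \<le> K" using nL fW fpos unfolding \<rho>1_def K_def by linarith
    show "2 ^ (n - r) + n * \<Delta> + 2 * r * \<tau> + \<rho>1 < K"
    proof -
      have "2 * r * \<tau> \<le> 2 * \<rho>1" using r\<tau>(1) by simp
      then show ?thesis using n\<Delta> fW fpos unfolding T \<rho>1_def K_def by linarith
    qed
    show "2 ^ r + D div (\<rho>1 + 1) \<le> U ^ 12 + 32 * W * U ^ 11"
    proof -
      have "D \<le> 32 * W * U ^ 11 * \<rho>1"
      proof -
        have "D = 16 * (f * U ^ 11 * U)" by (simp add: D_def p12)
        also have "\<dots> \<le> 16 * (f * U ^ 11 * (4 * W\<^sup>2))" using UW by simp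
        also have "\<dots> = 32 * W * U ^ 11 * \<rho>1" by (simp add: \<rho>1_def power2_eq_square)
        finally show ?thesis .
      qed
      also have "\<dots> \<le> 32 * W * U ^ 11 * (\<rho>1 + 1)" by simp
      finally have "D div (\<rho>1 + 1) \<le> 32 * W * U ^ 11"
        by (metis add_gr_0 div_le_mono nonzero_mult_div_cancel_right zero_less_one less_irrefl)
      then show ?thesis by (simp add: r)
    qed
    show "2 ^ r + r * (K * D div (\<tau> + 1)\<^sup>2) \<le> U ^ 12 + 32 * W * U ^ 11"
    proof -
      let ?Q = "K * D div (\<tau> + 1)\<^sup>2"
      have "?Q * \<rho>1\<^sup>2 \<le> ?Q * (r * (\<tau> + 1))\<^sup>2"
        using r\<tau>(2) by (intro mult_le_mono2 power_mono) auto
      also have "\<dots> = r\<^sup>2 * (?Q * (\<tau> + 1)\<^sup>2)" by (simp only: power_mult_distrib mult.assoc mult.commute mult.left_commute)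
      also have "\<dots> \<le> r\<^sup>2 * (K * D)" by (intro mult_le_mono2 div_times_less_eq_dividend)
      finally have "r * (?Q * \<rho>1\<^sup>2) \<le> r * (r\<^sup>2 * (K * D))" by (rule mult_le_mono2)
      also have "\<dots> = r ^ 3 * (K * D)" by (simp add: power2_eq_square power3_eq_cube)
      also have "\<dots> \<le> r ^ 3 * (2 * f * U * D)"
      proof (intro mult_le_mono2 mult_le_mono1)
        show "K \<le> 2 * f * U" using WfU unfolding K_def by linarith
      qed
      also have "\<dots> = r ^ 3 * U\<^sup>2 * (32 * f\<^sup>2 * U ^ 11)" by (simp add: D_def p12 power2_eq_square)
      \<comment> \<open>The cubic lower bound on \<open>W\<close> enters here, since
        \<open>U\<^sup>2 = 2 ^ 18 * E\<^sup>2 * W\<^sup>2\<close>.\<close>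
      also have "r ^ 3 * U\<^sup>2 \<le> 4 * W ^ 3"
      proof -
        have "r ^ 3 * U\<^sup>2 = 4 * W\<^sup>2 * (2 ^ 16 * E\<^sup>2 * r ^ 3)" by (simp add: U power2_eq_square)
        also have "\<dots> \<le> 4 * W\<^sup>2 * W" using W by (rule mult_le_mono2)
        finally show ?thesis by (simp add: power2_eq_square power3_eq_cube)
      qed
      then have "r ^ 3 * U\<^sup>2 * (32 * f\<^sup>2 * U ^ 11) \<le> 4 * W ^ 3 * (32 * f\<^sup>2 * U ^ 11)"
        by (rule mult_le_mono1)
      also have "4 * W ^ 3 * (32 * f\<^sup>2 * U ^ 11) = 32 * W * U ^ 11 * \<rho>1\<^sup>2"
        by (simp add: \<rho>1_def power2_eq_square power3_eq_cube)
      finally have "r * ?Q * \<rho>1\<^sup>2 \<le> 32 * W * U ^ 11 * \<rho>1\<^sup>2" by (simp only: mult.assoc)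
      moreover have "0 < \<rho>1\<^sup>2" using pos fpos by (simp add: \<rho>1_def)
      ultimately have "r * ?Q \<le> 32 * W * U ^ 11" by (simp only: mult_le_cancel2) 
      then show ?thesis by (simp only: r add_le_cancel_left)
    qed
    show "(2 ^ r + (U ^ 12 + 32 * W * U ^ 11) + 64 * W * U ^ 11) * K + D \<le> card V"
    proof -
      \<comment> \<open>The leading term is \<open>2 * 2 ^ n\<close>. All corrections together
        amount to at most 182 of the 512 available multiples of
        \<open>W * (f * U ^ 12)\<close>.\<close>
      have "(2 ^ r + (U ^ 12 + 32 * W * U ^ 11) + 64 * W * U ^ 11) * K + D
        = 2 * (f * U ^ 13) + 160 * (W * (f * U ^ 12)) + 6 * (512 * W * (W * (f * U ^ 11))) + 16 * (f * U ^ 12)"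
        unfolding r K_def D_def by (simp add: p12 p13 algebra_simps)
      moreover have "512 * W * (W * (f * U ^ 11)) \<le> W * (f * U ^ 12)"
        using mult_le_mono1[OF Upos(2), of "W * (f * U ^ 11)"] by (simp add: p12 algebra_simps)
      moreover have "f * U ^ 12 \<le> W * (f * U ^ 12)" using pos by simp
      moreover have "card V = 2 * (f * U ^ 13) + 512 * (W * (f * U ^ 12))" unfolding V by simp
      ultimately show ?thesis by linarith
    qed
    show "card V * (4 * n * L) + 2 * (f * U ^ 12) * K \<le> D * K"
    proof -
      have "512 * W * f * U ^ 12 \<le> f * U * U ^ 12" using WfU by (intro mult_le_mono1) simp
      then have "card V \<le> 3 * (f * U ^ 13)" unfolding V f12(2) by simp
      then have "card V * (4 * n * L) \<le> 3 * (f * U ^ 13) * f" using nL by (intro mult_le_mono)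
      also have "\<dots> = 3 * (f * U ^ 12) * (f * U)" by (simp add: p13)
      also have "\<dots> \<le> 3 * (f * U ^ 12) * K" by (intro mult_le_mono2) (simp add: K_def)
      finally have "card V * (4 * n * L) + 2 * (f * U ^ 12) * K \<le> 5 * (f * U ^ 12) * K"
        by (simp only: mult.assoc)
      also have "\<dots> \<le> D * K" by (simp add: D_def)
      finally show ?thesis .
    qed
    show "2 * (2 * (f * U ^ 12)) + 4 * n * L \<le> D" using nL f12(1) unfolding D_def by linarith
  qed
qed

end

text \<open>With \<open>16 ^ (t - 1) \<le> n < 16 ^ t\<close>, the choice \<open>U = 2 ^ t\<close>
  gives \<open>n < U ^ 4 \<le> 16 * n\<close>. The sizes are powers of two, and the exponent of
  \<open>\<Delta>\<close> is the one that makes \<open>2 ^ (n - r) = f * U\<close>.\<close>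

lemma triangle_free_cube_embeds:
  fixes e :: nat
  shows "\<exists>n0. \<forall>n\<ge>n0. \<forall>(V :: 'a set) adj. triangle_free V adj \<longrightarrow>
    card V = 2 ^ (n + 1) + 2 ^ (n - e) \<longrightarrow> triangle_free.cube_embeds V adj n"
proof -
  \<comment> \<open>\<open>1728 = 12 ^ 3\<close> comes from \<open>r = 12 * t\<close>, and
    \<open>2 ^ (3 * e + 9)\<close> is \<open>E\<^sup>2 * (512 * E)\<close>. So
    \<open>c \<le> t\<close> and \<open>t ^ 4 \<le> 2 ^ t\<close> yield the lower bound on
    \<open>W\<close>.\<close>
  define c :: nat where "c = 2 ^ 16 * 1728 * 2 ^ (3 * e + 9)"
  define t0 where "t0 = c + e + 16"
  have "triangle_free.cube_embeds V adj n"
    if n0: "16 ^ t0 \<le> n" and G: "triangle_free V adj" and V: "card V = 2 ^ (n + 1) + 2 ^ (n - e)"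
    for n and V :: "'a set" and adj
  proof -
    interpret triangle_free V adj by (rule G)
    have "1 \<le> n" using n0 by (meson one_le_numeral one_le_power order_trans)
    then obtain j where j: "16 ^ j \<le> n" "n < 16 ^ (j + 1)"
      using ex_power_ivl1[of 16 n] by auto
    define t where "t = j + 1"
    have "(16 :: nat) ^ t0 < 16 ^ t" using n0 j(2) by (simp add: t_def)
    then have "t0 < t" by (simp add: power_strict_increasing_iff)
    then have t: "c \<le> t" "e + 9 \<le> t" "16 \<le> t" by (simp_all add: t0_def)
    define U W E r s h \<Delta> f :: nat
      where "U = 2 ^ t" and "W = 2 ^ (t - e - 9)" and "E = 2 ^ e"
        and "r = 12 * t" and "s = 4 * t + 3" and "h = 2 ^ (3 * t - 1)"
        and "\<Delta> = 2 ^ (n + e + 4 - 24 * t)" and "f = 32 * W * \<Delta> * U ^ 10"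
    have U: "U = 512 * E * W"
    proof -
      have "512 * E * W = 2 ^ (9 + e + (t - e - 9))" by (simp add: E_def W_def power_add)
      then show ?thesis using t by (simp add: U_def)
    qed
    have pos: "1 \<le> U" "1 \<le> W" "1 \<le> E" "1 \<le> r" "W \<le> U"
      using t U by (simp_all add: U_def W_def E_def r_def power_increasing)
    have U4: "U ^ 4 = 16 ^ t" by (simp add: U_def power_mult[symmetric] mult.commute[of t]) (simp add: power_mult)
    have W: "2 ^ 16 * E\<^sup>2 * r ^ 3 \<le> W"
    proof -
      have "2 ^ 16 * E\<^sup>2 * r ^ 3 * (512 * E) = c * t ^ 3"
        by (simp add: c_def E_def r_def power_mult_distrib power_add power_mult power2_eq_square power3_eq_cube algebra_simps)
      also have "\<dots> \<le> t * t ^ 3" using t by (intro mult_le_mono1)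
      also have "\<dots> = t ^ 4" by (simp add: eval_nat_numeral)
      also have "\<dots> \<le> W * (512 * E)"
        using pow4_le_two_pow[OF t(3)] U by (simp add: U_def[symmetric] algebra_simps)
      finally show ?thesis using pos by (simp only: mult_le_cancel2)
    qed
    have rW: "2 ^ 16 * r ^ k \<le> W" if "k \<le> 3" for k
    proof -
      have "2 ^ 16 * r ^ k \<le> 2 ^ 16 * 1 * r ^ 3"
        using pos that by (simp add: power_increasing)
      also have "\<dots> \<le> 2 ^ 16 * E\<^sup>2 * r ^ 3" using pos by (intro mult_le_mono) auto
      finally show ?thesis using W by linarith
    qed
    have h: "2 * h = U ^ 3"
    proof -
      have "2 * h = 2 ^ Suc (3 * t - 1)" by (simp add: h_def)
      also have "Suc (3 * t - 1) = t * 3" using t by simp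
      finally show ?thesis by (simp add: U_def power_mult)
    qed
    have len: "r * (2 * h + 1) + s \<le> n"
    proof -
      have "s \<le> r" using t by (simp add: s_def r_def)
      moreover have "1 \<le> U ^ 3" using pos by simp
      then have "r \<le> r * U ^ 3" by simp
      moreover have "r * (2 * h + 1) = r * U ^ 3 + r" by (simp only: h distrib_left mult_1_right)
      ultimately have "r * (2 * h + 1) + s \<le> 3 * (r * U ^ 3)" by linarith
      then have "16 * (r * (2 * h + 1) + s) \<le> 16 * (3 * (r * U ^ 3))" by (rule mult_le_mono2)
      moreover have "48 * r \<le> U" using rW[of 1] pos(5) by simp
      then have "16 * (3 * (r * U ^ 3)) \<le> U * U ^ 3"
        using mult_le_mono1[of "48 * r" U "U ^ 3"] by simp
      moreover have "U * U ^ 3 = U ^ 4" by (simp flip: power_Suc)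
      ultimately have "16 * (r * (2 * h + 1) + s) \<le> U ^ 4" by linarith
      also have "U ^ 4 \<le> 16 * n" using j(1) unfolding U4 t_def by simp
      finally show ?thesis by simp
    qed
    have n24: "24 * t \<le> n"
    proof -
      have "r * 2 \<le> r * (2 * h + 1)"
        by (intro mult_le_mono2) (simp add: h_def)
      also have "\<dots> \<le> n" using len by simp
      finally show ?thesis by (simp add: r_def)
    qed
    have T: "2 ^ (n - r) = f * U"
    proof -
      have "f * U = 2 ^ (5 + (t - e - 9) + (n + e + 4 - 24 * t) + t * 10 + t)"
        unfolding f_def W_def \<Delta>_def U_def power_add power_mult by simp
      also have "5 + (t - e - 9) + (n + e + 4 - 24 * t) + t * 10 + t = n - r"
        using n24 t by (simp add: r_def)
      finally show ?thesis by simp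
    qed
    have r12: "2 ^ r = U ^ 12" by (simp add: U_def r_def power_mult[symmetric] mult.commute)
    have fn: "f * U ^ 13 = 2 ^ n"
    proof -
      have "f * U ^ 13 = f * U * U ^ 12" by (simp flip: power_Suc)
      also have "\<dots> = 2 ^ (n - r) * 2 ^ r" by (simp only: T r12)
      also have "\<dots> = 2 ^ n" using n24 by (simp add: r_def flip: power_add)
      finally show ?thesis .
    qed
    have "512 * W * f * U ^ 12 = 2 ^ (n - e)"
    proof -
      have "e \<le> n" using n24 t by simp
      then have "E * 2 ^ (n - e) = 2 ^ n" by (simp add: E_def flip: power_add)
      moreover have "E * (512 * W * f * U ^ 12) = f * U ^ 13"
      proof -
        have "E * (512 * W * f * U ^ 12) = (512 * E * W) * f * U ^ 12" by simp
        also have "\<dots> = f * U ^ 13" by (simp flip: U power_Suc)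
        finally show ?thesis .
      qed
      ultimately have "E * (512 * W * f * U ^ 12) = E * 2 ^ (n - e)" using fn by simp
      then show ?thesis using pos by simp
    qed
    then have V': "card V = 2 * (f * U ^ 13) + 512 * W * f * U ^ 12" unfolding V fn by simp
    have bin: "r * U * ((2 * h + 1) choose h) \<le> 2 ^ (2 * h)"
    proof (rule middle_binomial_le)
      have "4 * r\<^sup>2 \<le> U" using rW[of 2] pos(5) by simp
      then have "4 * r\<^sup>2 * U\<^sup>2 \<le> U * U\<^sup>2" by (rule mult_le_mono1)
      moreover have "U * U\<^sup>2 = U ^ 3" by (simp flip: power_Suc)
      ultimately show "4 * (r * U)\<^sup>2 \<le> 2 * h + 1"
        unfolding h by (simp add: power_mult_distrib)
    qed
    show ?thesis
    proof (rule embed_cube_powers[OF U pos(2,3) _ _ _ _ r12 _ f_def T W pos(4) bin len V'])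
      show "n \<le> U ^ 4" using j(2) unfolding U4 t_def by simp
      show "2 ^ s = 8 * U ^ 4" by (simp add: U4 s_def power_add power_mult)
    qed (use \<open>1 \<le> n\<close> in \<open>simp_all add: \<Delta>_def h_def\<close>)
  qed
  then show ?thesis by blast
qed

section \<open>The Ramsey number\<close>

lemma not_Blue_iff: "c \<noteq> Blue \<longleftrightarrow> c = Red"
  by (cases c) auto

lemma triangle_copyI:
  assumes "u < N" "v < N" "w < N" "u \<noteq> v" "v \<noteq> w" "u \<noteq> w"
    and "\<chi> {u, v} = Blue" "\<chi> {v, w} = Blue" "\<chi> {u, w} = Blue"
  shows "contains_copy (colour_subgraph (complete_graph N) \<chi> Blue) (complete_graph 3)"
proof -
  define f where "f i = (if i = 0 then u else if i = 1 then v else w)" for i :: nat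
  have less3: "{..<3} = {0, 1, 2 :: nat}" by auto
  have "f ` e \<in> {e \<in> [{..<N}]\<^bsup>2\<^esup>. \<chi> e = Blue}" if "e \<in> [{..<3}]\<^bsup>2\<^esup>" for e
  proof -
    obtain i j where e: "e = {i, j}" "i \<noteq> j" "i \<in> {0, 1, 2}" "j \<in> {0, 1, 2}"
      using \<open>e \<in> [{..<3}]\<^bsup>2\<^esup>\<close> unfolding nsets_def less3 by (auto simp: card_2_iff)
    then show ?thesis
      using assms by (auto simp: f_def nsets_def insert_commute)
  qed
  moreover have "inj_on f {..<3}" "f ` {..<3} \<subseteq> {..<N}"
    using assms by (auto simp: less3 f_def)
  ultimately show ?thesis
    unfolding contains_copy_def colour_subgraph_def complete_graph_def by auto
qed

text \<open>An edge is an unordered pair, so the pair supplied by \<open>hypercube\<close> may be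
  the reversed one.\<close>

lemma hypercube_edgeD:
  assumes "{x, y} \<in> edges (hypercube n)"
  shows "length x = n \<and> length y = n \<and> card {i. i < n \<and> x ! i \<noteq> y ! i} = 1"
proof -
  obtain x' y' where eq: "{x, y} = {x', y'}" and xy: "length x' = n" "length y' = n"
    "card {i. i < n \<and> x' ! i \<noteq> y' ! i} = 1"
    using assms by (auto simp: hypercube_def)
  from eq consider "x = x'" "y = y'" | "x = y'" "y = x'" by (auto simp: doubleton_eq_iff)
  then show ?thesis
  proof cases
    case 2
    have "{i. i < n \<and> y' ! i \<noteq> x' ! i} = {i. i < n \<and> x' ! i \<noteq> y' ! i}" by auto
    with 2 xy show ?thesis by metis
  qed (use xy in simp)
qed

text \<open>If there is no blue triangle, the blue graph is an instance of
  \<open>triangle_free\<close>, and its non-edges between distinct vertices are red.\<close>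

lemma ramsey_prop_upper:
  fixes e :: nat
  shows "\<exists>n0. \<forall>n\<ge>n0. ramsey_prop (complete_graph 3) (hypercube n) (2 ^ (n + 1) + 2 ^ (n - e))"
proof -
  obtain n0 where n0: "\<And>n (V :: nat set) adj. n0 \<le> n \<Longrightarrow> triangle_free V adj \<Longrightarrow>
    card V = 2 ^ (n + 1) + 2 ^ (n - e) \<Longrightarrow> triangle_free.cube_embeds V adj n"
    using triangle_free_cube_embeds[of e, where 'a = nat] by metis
  have "ramsey_prop (complete_graph 3) (hypercube n) (2 ^ (n + 1) + 2 ^ (n - e))" if "n0 \<le> n" for n
    unfolding ramsey_prop_def
  proof (intro allI)
    fix \<chi> :: "nat set \<Rightarrow> colour"
    define N :: nat where "N = 2 ^ (n + 1) + 2 ^ (n - e)"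
    \<comment> \<open>The bounds on \<open>u\<close> and \<open>v\<close> are part of
      \<open>adj\<close> because the locale axioms range over all naturals.\<close>
    define adj where "adj u v \<longleftrightarrow> u < N \<and> v < N \<and> u \<noteq> v \<and> \<chi> {u, v} = Blue" for u v
    have "contains_copy (colour_subgraph (complete_graph N) \<chi> Red) (hypercube n)"
      if no: "\<not> contains_copy (colour_subgraph (complete_graph N) \<chi> Blue) (complete_graph 3)"
    proof -
      interpret triangle_free "{..<N}" adj
      proof
        show "\<not> adj u w" if "adj u v" "adj v w" for u v w
          using no triangle_copyI[of u N v w \<chi>] that by (auto simp: adj_def)
      qed (auto simp: adj_def insert_commute)
      have "cube_embeds n"
        by (rule n0[OF \<open>n0 \<le> n\<close>]) (unfold_locales, simp add: N_def)
      then obtain g where g: "inj_on g (Pow {..<n})" "g ` Pow {..<n} \<subseteq> {..<N}"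
        "\<And>S S'. S \<in> Pow {..<n} \<Longrightarrow> S' \<in> Pow {..<n} \<Longrightarrow> cube_adj n S S' \<Longrightarrow> \<not> adj (g S) (g S')"
        by (auto simp: cube_embeds_def)
      \<comment> \<open>Supports identify Boolean lists of length \<open>n\<close> with subsets of
        \<open>{..<n}\<close>.\<close>
      define supp where "supp x = {i. i < n \<and> x ! i}" for x :: "bool list"
      have supp_sub: "supp x \<in> Pow {..<n}" for x by (auto simp: supp_def)
      have supp_inj: "x = y" if "length x = n" "length y = n" "supp x = supp y" for x y
      proof (rule nth_equalityI)
        fix i assume "i < length x"
        then have "i \<in> supp x \<longleftrightarrow> x ! i" "i \<in> supp y \<longleftrightarrow> y ! i" using that by (auto simp: supp_def)
        then show "x ! i = y ! i" using that by simp
      qed (use that in simp)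
      have edge: "g ` supp ` d \<in> {d \<in> [{..<N}]\<^bsup>2\<^esup>. \<chi> d = Red}" if "d \<in> edges (hypercube n)" for d
      proof -
        obtain x y where d: "d = {x, y}" using \<open>d \<in> edges (hypercube n)\<close> by (auto simp: hypercube_def)
        have xy: "length x = n" "length y = n" "card {i. i < n \<and> x ! i \<noteq> y ! i} = 1"
          using hypercube_edgeD \<open>d \<in> edges (hypercube n)\<close> by (auto simp: d)
        then obtain j where j: "{i. i < n \<and> x ! i \<noteq> y ! i} = {j}" by (auto simp: card_1_singleton_iff)
        then have "j < n" by blast
        moreover have "supp y = flip j (supp x)"
        proof (rule set_eqI)
          fix i
          have "i < n \<and> x ! i \<noteq> y ! i \<longleftrightarrow> i = j" using j by blast
          then show "i \<in> supp y \<longleftrightarrow> i \<in> flip j (supp x)"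
            using \<open>j < n\<close> unfolding supp_def flip_def by (cases "i = j") auto
        qed
        ultimately have adj: "cube_adj n (supp x) (supp y)" by (auto simp: cube_adj_def)
        have "supp x \<noteq> supp y" using adj cube_adj_irrefl by metis
        then have "g (supp x) \<noteq> g (supp y)" using g(1) supp_sub by (auto simp: inj_on_def)
        moreover have "g (supp x) < N" "g (supp y) < N" using g(2) supp_sub by auto
        moreover have "\<not> adj (g (supp x)) (g (supp y))" using g(3)[OF supp_sub supp_sub adj] .
        ultimately show ?thesis by (auto simp: d adj_def nsets_def not_Blue_iff)
      qed
      show ?thesis
        unfolding contains_copy_def
      proof (intro exI[of _ "g \<circ> supp"] conjI)
        have "inj_on supp {x. length x = n}" using supp_inj by (auto simp: inj_on_def)
        then show "inj_on (g \<circ> supp) (verts (hypercube n))"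
          using g(1) supp_sub by (auto simp: hypercube_def intro!: comp_inj_on intro: inj_on_subset)
        show "(g \<circ> supp) ` verts (hypercube n) \<subseteq> verts (colour_subgraph (complete_graph N) \<chi> Red)"
          using g(2) supp_sub by (auto simp: colour_subgraph_def complete_graph_def)
        show "\<forall>d\<in>edges (hypercube n). (g \<circ> supp) ` d \<in> edges (colour_subgraph (complete_graph N) \<chi> Red)"
          using edge by (simp add: colour_subgraph_def complete_graph_def image_comp)
      qed
    qed
    then show "contains_copy (colour_subgraph (complete_graph (2 ^ (n + 1) + 2 ^ (n - e))) \<chi> Red) (hypercube n) \<or>
       contains_copy (colour_subgraph (complete_graph (2 ^ (n + 1) + 2 ^ (n - e))) \<chi> Blue) (complete_graph 3)"
      unfolding N_def by blast
  qed
  then show ?thesis by blast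
qed

section \<open>The lower bound and the asymptotics\<close>

text \<open>Connectedness of the cube, stated for functions constant along edges. Switching off one
  true entry follows an edge and lowers the number of true entries.\<close>

lemma hypercube_connected:
  assumes step: "\<And>x y. {x, y} \<in> edges (hypercube n) \<Longrightarrow> F x = F y"
    and "length x = n"
  shows "F x = F (replicate n False)"
  using assms(2)
proof (induction "card {i. i < n \<and> x ! i}" arbitrary: x)
  case 0
  then have "x = replicate n False" by (intro nth_equalityI) auto
  then show ?case by simp
next
  case (Suc m)
  then have "{i. i < n \<and> x ! i} \<noteq> {}" by (metis card.empty nat.distinct(1))
  then obtain i where i: "i < n" "x ! i" by blast
  define y where "y = x[i := False]"
  have y: "y ! k \<longleftrightarrow> x ! k \<and> k \<noteq> i" if "k < n" for k
    using that i Suc.prems by (auto simp: y_def nth_list_update)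
  then have "{k. k < n \<and> y ! k} = {k. k < n \<and> x ! k} - {i}" by blast
  then have "m = card {k. k < n \<and> y ! k}" using i Suc.hyps(2) by simp
  then have Fy: "F y = F (replicate n False)" using Suc.prems by (intro Suc.hyps(1)) (simp_all add: y_def)
  have "{k. k < n \<and> x ! k \<noteq> y ! k} = {i}"
    using i y by blast
  then have "card {k. k < n \<and> x ! k \<noteq> y ! k} = 1" by simp
  moreover have "length y = n" using Suc.prems by (simp add: y_def)
  ultimately have "{x, y} \<in> edges (hypercube n)"
    using Suc.prems unfolding hypercube_def snd_conv by blast
  then show ?case using step[of x y] Fy by simp
qed

text \<open>Blue is complete bipartite between \<open>{..<m}\<close> and the rest, hence without
  triangles. A red cube is connected and stays on one side, but each side has at most
  \<open>2 ^ n - 1\<close> vertices.\<close>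

lemma ramsey_prop_lower:
  assumes "N + 2 \<le> 2 ^ (n + 1)"
  shows "\<not> ramsey_prop (complete_graph 3) (hypercube n) N"
proof -
  define m :: nat where "m = 2 ^ n - 1"
  define \<chi> where "\<chi> d = (if \<exists>u\<in>d. \<exists>v\<in>d. u < m \<and> \<not> v < m then Blue else Red)" for d :: "nat set"
  have "\<not> contains_copy (colour_subgraph (complete_graph N) \<chi> Blue) (complete_graph 3)"
  proof
    assume "contains_copy (colour_subgraph (complete_graph N) \<chi> Blue) (complete_graph 3)"
    then obtain f :: "nat \<Rightarrow> nat" where "\<forall>d\<in>[{..<3}]\<^bsup>2\<^esup>. \<chi> (f ` d) = Blue"
      by (auto simp: contains_copy_def colour_subgraph_def complete_graph_def)
    moreover have "{0, 1} \<in> [{..<3 :: nat}]\<^bsup>2\<^esup>" "{1, 2} \<in> [{..<3 :: nat}]\<^bsup>2\<^esup>" "{0, 2} \<in> [{..<3 :: nat}]\<^bsup>2\<^esup>"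
      by (auto simp: nsets_def)
    ultimately have "\<chi> (f ` {0, 1}) = Blue" "\<chi> (f ` {1, 2}) = Blue" "\<chi> (f ` {0, 2}) = Blue" by blast+
    then show False by (auto simp: \<chi>_def split: if_splits)
  qed
  moreover have "\<not> contains_copy (colour_subgraph (complete_graph N) \<chi> Red) (hypercube n)"
  proof
    assume "contains_copy (colour_subgraph (complete_graph N) \<chi> Red) (hypercube n)"
    then obtain f where f: "inj_on f {x. length x = n}" "f ` {x. length x = n} \<subseteq> {..<N}"
      "\<And>d. d \<in> edges (hypercube n) \<Longrightarrow> \<chi> (f ` d) = Red"
      by (auto simp: contains_copy_def colour_subgraph_def complete_graph_def hypercube_def)
    have "(f x < m) = (f y < m)" if "{x, y} \<in> edges (hypercube n)" for x y
      using f(3)[OF that] by (auto simp: \<chi>_def split: if_splits)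
    then have side: "(f x < m) = (f (replicate n False) < m)" if "length x = n" for x
      using hypercube_connected[of n "\<lambda>x. f x < m" x] that by blast
    have "card {x :: bool list. length x = n} = 2 ^ n"
      using card_lists_length_eq[of "UNIV :: bool set" n] by simp
    then have card: "card (f ` {x. length x = n}) = 2 ^ n" using f(1) by (simp add: card_image)
    show False
    proof (cases "f (replicate n False) < m")
      case True
      then have "f x < m" if "length x = n" for x using side[OF that] by blast
      then have "f ` {x. length x = n} \<subseteq> {..<m}" by blast
      then have "card (f ` {x. length x = n}) \<le> m" using card_mono[of "{..<m}"] by simp
      moreover have "m < 2 ^ n" by (simp add: m_def)
      ultimately show False using card by simp
    next
      case False
      then have "m \<le> f x" if "length x = n" for x using side[OF that] False by (meson not_less)
      then have "f ` {x. length x = n} \<subseteq> {m..<N}" using f(2) by fastforce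
      then have "card (f ` {x. length x = n}) \<le> N - m" using card_mono[of "{m..<N}"] by simp
      then show False using card assms by (simp add: m_def)
    qed
  qed
  ultimately show ?thesis unfolding ramsey_prop_def by blast
qed

theorem theorem1p1:
  shows "\<exists>\<epsilon> :: nat \<Rightarrow> real. \<epsilon> \<in> o(\<lambda>_. 1) \<and>
    (\<forall>n. real (ramsey_number (complete_graph 3) (hypercube n)) = (1 + \<epsilon> n) * 2 ^ (n + 1))"
proof -
  define R where "R n = ramsey_number (complete_graph 3) (hypercube n)" for n
  define \<epsilon> where "\<epsilon> n = real (R n) / 2 ^ (n + 1) - 1" for n
  \<comment> \<open>\<open>R n\<close> itself has the Ramsey property, so it cannot satisfy
    \<open>R n + 2 \<le> 2 ^ (n + 1)\<close>.\<close>
  have low: "2 ^ (n + 1) \<le> R n + 1" for n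
  proof -
    have "ramsey_prop (complete_graph 3) (hypercube n) (R n)"
      unfolding R_def ramsey_number_def using ramsey_prop_triangle_hypercube by (rule LeastI_ex)
    then show ?thesis using ramsey_prop_lower[of "R n" n] by fastforce
  qed
  have "(\<epsilon> \<longlongrightarrow> 0) sequentially"
  proof (rule LIMSEQ_I)
    fix \<delta> :: real assume "0 < \<delta>"
    then obtain e where e: "(1 / 2) ^ e < \<delta>" using real_arch_pow_inv[of \<delta> "1 / 2"] by auto
    obtain n0 where n0: "\<And>n. n0 \<le> n \<Longrightarrow>
      ramsey_prop (complete_graph 3) (hypercube n) (2 ^ (n + 1) + 2 ^ (n - e))"
      using ramsey_prop_upper[of e] by blast
    \<comment> \<open>The surplus \<open>2 ^ (n - e)\<close> is the fraction
      \<open>(1 / 2) ^ e\<close> of \<open>2 ^ n\<close>; the bound \<open>e \<le> n\<close>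
      prevents truncation of \<open>n - e\<close>.\<close>
    have "norm (\<epsilon> n - 0) < \<delta>" if n: "max n0 e \<le> n" for n
    proof -
      have "R n \<le> 2 ^ (n + 1) + 2 ^ (n - e)"
        unfolding R_def ramsey_number_def using n0 n by (intro Least_le) auto
      then have "real (R n) \<le> real (2 ^ (n + 1) + 2 ^ (n - e))" by (simp only: of_nat_le_iff)
      then have up: "real (R n) - 2 ^ (n + 1) \<le> 2 ^ (n - e)" by simp
      have "real (2 ^ (n + 1)) \<le> real (R n + 1)" using low by (simp only: of_nat_le_iff)
      then have "2 ^ (n + 1) - real (R n) \<le> 1" by simp
      also have "(1 :: real) \<le> 2 ^ (n - e)" by simp
      finally have "\<bar>real (R n) - 2 ^ (n + 1)\<bar> \<le> 2 ^ (n - e)" using up by linarith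
      moreover have "\<epsilon> n = (real (R n) - 2 ^ (n + 1)) / 2 ^ (n + 1)"
        by (simp add: \<epsilon>_def diff_divide_distrib)
      ultimately have "\<bar>\<epsilon> n\<bar> \<le> 2 ^ (n - e) / 2 ^ (n + 1)"
        by (simp add: abs_divide divide_right_mono)
      also have "\<dots> \<le> 2 ^ (n - e) / 2 ^ n" by (intro divide_left_mono) auto
      also have "\<dots> = (1 / 2) ^ e" using n by (simp add: power_diff power_one_over field_simps)
      finally show ?thesis using e by simp
    qed
    then show "\<exists>n1. \<forall>n\<ge>n1. norm (\<epsilon> n - 0) < \<delta>" by blast
  qed
  then have "\<epsilon> \<in> o(\<lambda>_. 1)" by (intro smalloI_tendsto) simp_all
  moreover have "real (R n) = (1 + \<epsilon> n) * 2 ^ (n + 1)" for n by (simp add: \<epsilon>_def)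
  ultimately show ?thesis unfolding R_def by blast
qed

end
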